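(* Let $g:\mathbb R^n\to\mathbb R$ be Lipschitz with constant $c$ with respect to the $\ell^1$-norm, and let $(S_T^1,\dots,S_T^n)$ be an i.i.d. vector of Lévy's stochastic areas on $[0,T]$. Then, for all $x>0$, $$P\big(g(S_T^1,\dots,S_T^n)-E[g(S_T^1,\dots,S_T^n)]\ge x\big)\le\left(1+\frac{\pi x}{4ncT}\right)^{4n}\exp\left(-\frac{\pi x}{cT}\right).$$
   Context: Lévy's stochastic area on $[0,T]$ is $S_T=\frac12\int_0^T\big(B^1(t)\,dB^2(t)-B^2(t)\,dB^1(t)\big)$, where $(B^1(t),B^2(t))_{t\ge0}$ is a two-dimensional Brownian motion. *)

theory Defs
  imports "HOL-Probability.Probability"
begin

definition natural_filtration ::
  "'a measure \<Rightarrow> (real \<Rightarrow> 'a \<Rightarrow> 'b::topological_space) \<Rightarrow> real \<Rightarrow> 'a measure" where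
  "natural_filtration M B t =
     sigma (space M) (\<Union>s\<in>{0..t}. {B s -` A \<inter> space M | A. A \<in> sets borel})"

text \<open>Standard d-dimensional Brownian motion: the increment over [s,t] is independent of the
  past and has law N(0, (t - s) I), i.e. its coordinates are independent centred normal variables
  with standard deviation sqrt (t - s).  Only the values at times t >= 0 matter.\<close>

definition brownian_motion ::
  "'a measure \<Rightarrow> (real \<Rightarrow> 'a \<Rightarrow> real ^ 'd) \<Rightarrow> bool" where
  "brownian_motion M B \<longleftrightarrow>
     prob_space M \<and>
     (\<forall>t\<ge>0. B t \<in> borel_measurable M) \<and>
     (\<forall>\<omega>\<in>space M. continuous_on {0..} (\<lambda>t. B t \<omega>)) \<and>
     (AE \<omega> in M. B 0 \<omega> = 0) \<and>
     (\<forall>s t. 0 \<le> s \<and> s < t \<longrightarrow>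
        prob_space.indep_set M (sets (natural_filtration M B s))
          {(\<lambda>\<omega>. B t \<omega> - B s \<omega>) -` A \<inter> space M | A. A \<in> sets borel} \<and>
        prob_space.indep_vars M (\<lambda>_. borel) (\<lambda>i \<omega>. (B t \<omega> - B s \<omega>) $ i) UNIV \<and>
        (\<forall>i. distributed M lborel (\<lambda>\<omega>. (B t \<omega> - B s \<omega>) $ i)
               (normal_density 0 (sqrt (t - s)))))"

text \<open>A triple of k, \<open>\<tau>\<close>, \<open>\<xi>\<close> encodes the simple process that equals \<open>\<xi> j\<close> on the interval
  from \<open>\<tau> j\<close> (excluded) to \<open>\<tau> (Suc j)\<close> (included), for j < k.\<close>

definition simple_process_data ::
  "'a measure \<Rightarrow> (real \<Rightarrow> 'a measure) \<Rightarrow> real \<Rightarrow> nat \<Rightarrow> (nat \<Rightarrow> real) \<Rightarrow> (nat \<Rightarrow> 'a \<Rightarrow> real) \<Rightarrow> bool" where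
  "simple_process_data M F T k \<tau> \<xi> \<longleftrightarrow>
     \<tau> 0 = 0 \<and> \<tau> k = T \<and>
     (\<forall>j<k. \<tau> j < \<tau> (Suc j)) \<and>
     (\<forall>j<k. \<xi> j \<in> borel_measurable (F (\<tau> j))) \<and>
     (\<forall>j<k. integrable M (\<lambda>\<omega>. (\<xi> j \<omega>)\<^sup>2))"

definition simple_process ::
  "nat \<Rightarrow> (nat \<Rightarrow> real) \<Rightarrow> (nat \<Rightarrow> 'a \<Rightarrow> real) \<Rightarrow> real \<Rightarrow> 'a \<Rightarrow> real" where
  "simple_process k \<tau> \<xi> t \<omega> = (\<Sum>j<k. \<xi> j \<omega> * indicator {\<tau> j<..\<tau> (Suc j)} t)"

definition simple_ito_integral ::
  "nat \<Rightarrow> (nat \<Rightarrow> real) \<Rightarrow> (nat \<Rightarrow> 'a \<Rightarrow> real) \<Rightarrow> (real \<Rightarrow> 'a \<Rightarrow> real) \<Rightarrow> 'a \<Rightarrow> real" where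
  "simple_ito_integral k \<tau> \<xi> W \<omega> = (\<Sum>j<k. \<xi> j \<omega> * (W (\<tau> (Suc j)) \<omega> - W (\<tau> j) \<omega>))"

text \<open>The random variable I is (a version of) the Ito integral of H against W over [0,T], where W
  is meant to be a one-dimensional Brownian motion relative to F: H is adapted and jointly
  measurable, simple processes approximate H in the L2 space of the product of dt and P, and their
  integrals converge to I in L2(P).\<close>

definition has_ito_integral ::
  "'a measure \<Rightarrow> (real \<Rightarrow> 'a measure) \<Rightarrow> (real \<Rightarrow> 'a \<Rightarrow> real) \<Rightarrow> real \<Rightarrow>
   (real \<Rightarrow> 'a \<Rightarrow> real) \<Rightarrow> ('a \<Rightarrow> real) \<Rightarrow> bool" where
  "has_ito_integral M F W T H I \<longleftrightarrow>
     (\<forall>t\<in>{0..T}. H t \<in> borel_measurable (F t)) \<and>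
     (\<lambda>(t, \<omega>). H t \<omega>) \<in> borel_measurable (restrict_space borel {0..T} \<Otimes>\<^sub>M M) \<and>
     I \<in> borel_measurable M \<and>
     (\<exists>k \<tau> \<xi>.
        (\<forall>m::nat. simple_process_data M F T (k m) (\<tau> m) (\<xi> m)) \<and>
        (\<lambda>m. \<integral>\<^sup>+\<omega>. (\<integral>\<^sup>+t\<in>{0..T}. ennreal ((H t \<omega> - simple_process (k m) (\<tau> m) (\<xi> m) t \<omega>)\<^sup>2) \<partial>lborel) \<partial>M)
          \<longlonglongrightarrow> 0 \<and>
        (\<lambda>m. \<integral>\<^sup>+\<omega>. ennreal ((I \<omega> - simple_ito_integral (k m) (\<tau> m) (\<xi> m) W \<omega>)\<^sup>2) \<partial>M)
          \<longlonglongrightarrow> 0)"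

text \<open>Ito integrals are determined only up to null sets, so S is required to agree almost surely
  with half the difference of the two integrals.\<close>

definition levy_area ::
  "'a measure \<Rightarrow> (real \<Rightarrow> 'a \<Rightarrow> real ^ 2) \<Rightarrow> real \<Rightarrow> ('a \<Rightarrow> real) \<Rightarrow> bool" where
  "levy_area M B T S \<longleftrightarrow>
     S \<in> borel_measurable M \<and>
     (\<exists>I J.
        has_ito_integral M (natural_filtration M B) (\<lambda>t \<omega>. B t \<omega> $ 2) T (\<lambda>t \<omega>. B t \<omega> $ 1) I \<and>
        has_ito_integral M (natural_filtration M B) (\<lambda>t \<omega>. B t \<omega> $ 1) T (\<lambda>t \<omega>. B t \<omega> $ 2) J \<and>
        (AE \<omega> in M. S \<omega> = (1 / 2) * (I \<omega> - J \<omega>)))"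

end

theory Submission
  imports Defs
begin

text \<open>
  The exponential moment \<open>E exp(v S) \<le> 1 / cos(v T / 2)\<close>, \<open>\<bar>v\<bar> < \<pi> / T\<close>, is all that is needed of
  the law of the Levy area. It holds exactly for left-point Riemann sums over N equal pieces up to
  a factor at most 1, since integrating out the Gaussian increments one by one leads to a discrete
  Riccati recursion that the tangent solves; Ito's isometry and Fatou's lemma carry it over to the
  limit.

  Put \<open>u = \<lambda> c T / \<pi>\<close>. For one coordinate, both a symmetrization argument (u large) and an expansion
  around \<open>f 0\<close> (u small) give \<open>E exp(\<lambda> (f S - E f S)) \<le> exp(-4 u) / (1 - u)\<^sup>4\<close> for every
  c-Lipschitz f. Integrating out one coordinate preserves the Lipschitz constant in the others, so
  the bound tensorizes to its n-th power, and Chernoff's inequality with \<open>u = y / (4 n + y)\<close>,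
  \<open>y = \<pi> x / (c T)\<close>, is the claim.
\<close>

section \<open>Elementary inequalities\<close>

text \<open>The function exp(-4 u) / (1 - u)^4 is dictated by the claim: minimizing exp(-u y) times
  its n-th power over u gives exactly (1 + y / (4 n))^(4 n) * exp(-y). So everything rests on a
  sharp one-coordinate estimate, and its constants leave little room. The logarithm of the target
  starts with 2 u^2. Symmetrization yields 1 / cos(pi u / 2)^2, whose logarithm starts with pi^2 u^2
  / 4, about 2.47 u^2: too large near 0, but harmless near 1, where a pole of order 2 stands against
  one of order 4. Centring at \<open>F 0\<close> uses exp w <= w + cosh(11/9 w) and yields exp(1 /
  cos(11/9 * pi u / 2) - 1), whose exponent starts with about 1.84 u^2: good near 0, but infinite at
  u = 9/11. At u = 2/5 both comparisons hold, so the proof switches there. The factor 11/9 has to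
  exceed 1 for cosh to dominate, and to stay below 4 / pi for the quadratic terms to
  compare.\<close>

lemma exp_le_cosh_add:
  fixes y :: real
  assumes "0 \<le> y"
  shows "exp y \<le> cosh (11 / 9 * y) + y"
proof -
  \<comment> \<open>Value and first derivative of both sides of the claim agree at 0, so two
    integrations reduce it to this inequality between second derivatives.\<close>
  have conv: "exp z \<le> (11 / 9)\<^sup>2 * cosh (11 / 9 * z)" for z :: real
  proof -
    define q where "q = exp (- (2 / 9) * z)"
    have q: "q > 0" by (simp add: q_def)
    \<comment> \<open>In terms of q the inequality becomes 162/121 * q <= 1 + q^11. The number
      811/1000 is close to the minimizer (162/1331)^(1/10) of the difference, so the tangent bound
      taken there suffices.\<close>
    have "1 + 11 * (q / (811/1000) - 1) \<le> (1 + (q / (811/1000) - 1)) ^ 11"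
      using Bernoulli_inequality[of "q / (811/1000) - 1" 11] q by simp
    then have "(811/1000) ^ 11 * (1 + 11 * (q / (811/1000) - 1)) \<le> q ^ 11"
      by (simp add: power_divide field_simps)
    then have *: "162 / 121 * q \<le> 1 + q ^ 11"
      using q by (simp add: field_simps)
    have "exp z = exp (11 / 9 * z) * q"
      by (simp add: q_def flip: exp_add)
    moreover have "exp (- (11 / 9 * z)) = exp (11 / 9 * z) * q ^ 11"
      by (simp add: q_def flip: exp_add exp_of_nat_mult)
    ultimately have "(11 / 9)\<^sup>2 * cosh (11 / 9 * z) - exp z
        = exp (11 / 9 * z) * (121/162) * (1 + q ^ 11 - 162 / 121 * q)"
      by (simp add: cosh_def field_simps power2_eq_square)
    also have "\<dots> \<ge> 0" using * by simp
    finally show ?thesis by simp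
  qed
  have d1: "exp z \<le> 11 / 9 * sinh (11 / 9 * z) + 1" if "0 \<le> z" for z :: real
  proof -
    have "11 / 9 * sinh (11 / 9 * 0) + 1 - exp 0 \<le> 11 / 9 * sinh (11 / 9 * z) + 1 - exp (z::real)"
    proof (rule DERIV_nonneg_imp_nondecreasing[OF that])
      fix w :: real
      show "\<exists>d. ((\<lambda>w. 11 / 9 * sinh (11 / 9 * w) + 1 - exp w) has_real_derivative d) (at w) \<and> 0 \<le> d"
        using conv[of w]
        by (intro exI[of _ "(11 / 9)\<^sup>2 * cosh (11 / 9 * w) - exp w"] conjI)
           (auto intro!: derivative_eq_intros simp: power2_eq_square)
    qed
    then show ?thesis by simp
  qed
  have "cosh (11 / 9 * 0) + 0 - exp 0 \<le> cosh (11 / 9 * y) + y - exp (y::real)"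
  proof (rule DERIV_nonneg_imp_nondecreasing[OF assms])
    fix w :: real assume "0 \<le> w"
    then show "\<exists>d. ((\<lambda>w. cosh (11 / 9 * w) + w - exp w) has_real_derivative d) (at w) \<and> 0 \<le> d"
      using d1[of w]
      by (intro exI[of _ "11 / 9 * sinh (11 / 9 * w) + 1 - exp w"] conjI)
         (auto intro!: derivative_eq_intros)
  qed
  then show ?thesis by simp
qed

section \<open>Cosine against logarithm for small u\<close>

lemma pi_squared_less: "pi\<^sup>2 < 9.8697"
proof -
  have "pi < 3.1416" using pi_approx by simp
  then have "pi\<^sup>2 < 3.1416\<^sup>2" by (intro power_strict_mono) auto
  then show ?thesis by (simp add: power2_eq_square)
qed

lemma minus_ln_one_minus_ge:
  fixes u :: real
  assumes "0 \<le> u" "u < 1"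
  shows "u + u ^ 2 / 2 + u ^ 3 / 3 + u ^ 4 / 4 \<le> - ln (1 - u)"
proof -
  have "- ln (1 - 0) - (0 + 0 ^ 2 / 2 + 0 ^ 3 / 3 + 0 ^ 4 / 4)
      \<le> - ln (1 - u) - (u + u ^ 2 / 2 + u ^ 3 / 3 + u ^ 4 / 4)"
  proof (rule DERIV_nonneg_imp_nondecreasing[OF assms(1)])
    fix w :: real assume w: "0 \<le> w" "w \<le> u"
    have "(1 + w + w ^ 2 + w ^ 3) * (1 - w) \<le> 1"
      using w by (simp add: algebra_simps eval_nat_numeral)
    then have "1 + w + w ^ 2 + w ^ 3 \<le> 1 / (1 - w)"
      using w assms by (simp add: pos_le_divide_eq)
    then show "\<exists>d. ((\<lambda>u. - ln (1 - u) - (u + u ^ 2 / 2 + u ^ 3 / 3 + u ^ 4 / 4)) has_real_derivative d) (at w) \<and> 0 \<le> d"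
      using w assms
      by (intro exI[of _ "1 / (1 - w) - (1 + w + w ^ 2 + w ^ 3)"] conjI)
         (auto intro!: derivative_eq_intros)
  qed
  then show ?thesis by simp
qed

lemma one_minus_cos_le:
  fixes z :: real
  shows "1 - cos z \<le> z\<^sup>2 / 2"
proof -
  have "1 - cos z = 2 * (sin (z / 2))\<^sup>2" using cos_double_sin[of "z / 2"] by simp
  also have "(sin (z / 2))\<^sup>2 \<le> (z / 2)\<^sup>2"
    using abs_sin_x_le_abs_x[of "z / 2"] by (rule abs_le_square_iff[THEN iffD1])
  finally show ?thesis by (simp add: power2_eq_square)
qed

text \<open>Both sides are compared with 2 u^2 + 4/3 u^3 + u^4, the start of the power series of the
  right side. On the left, 1 - cos z <= z^2 / 2 leads to a / (1 - a) with a at most 1.85 u^2, where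
  1.85 rounds 121 pi^2 / 648 up.\<close>

lemma inverse_cos_le:
  fixes u :: real
  assumes "0 \<le> u" "u \<le> 2 / 5"
  shows "1 / cos (11 / 9 * (pi * u / 2)) - 1 \<le> - 4 * ln (1 - u) - 4 * u"
proof -
  define a where "a = (11 / 9 * (pi * u / 2))\<^sup>2 / 2"
  have "a = (121 / 648 * pi\<^sup>2) * u\<^sup>2" by (simp add: a_def power2_eq_square)
  moreover have "121 / 648 * pi\<^sup>2 \<le> 1.85" using pi_squared_less by simp
  ultimately have a: "a \<le> 1.85 * u\<^sup>2" by (metis mult_right_mono zero_le_power2)
  have a0: "0 \<le> a" by (simp add: a_def)
  have u2: "u\<^sup>2 \<le> 4 / 25"
    using power_mono[OF assms(2,1), of 2] by (simp add: power2_eq_square)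
  have u2u: "u\<^sup>2 \<le> 2 / 5 * u" using mult_right_mono[OF assms(2,1)] by (simp add: power2_eq_square)
  have c: "1 - a \<le> cos (11 / 9 * (pi * u / 2))"
    using one_minus_cos_le[of "11 / 9 * (pi * u / 2)"] unfolding a_def by linarith
  have a1: "1 - a > 0" using a u2 by simp
  have "1 / cos (11 / 9 * (pi * u / 2)) - 1 \<le> 1 / (1 - a) - 1"
    using c a1 by (simp add: frac_le)
  also have "\<dots> = a / (1 - a)" using a1 by (simp add: field_simps)
  also have "\<dots> \<le> 2 * u ^ 2 + 4 / 3 * u ^ 3 + u ^ 4"
  proof -
    define b where "b = 1.85 * u\<^sup>2"
    have b1: "1 - b > 0" using u2 by (simp add: b_def)
    have "a / (1 - a) \<le> b / (1 - b)"
      using a a0 a1 b1 unfolding b_def[symmetric] by (intro frac_le) auto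
    also have "\<dots> \<le> 2 * u ^ 2 + 4 / 3 * u ^ 3 + u ^ 4"
    proof -
      have u3: "u ^ 3 \<le> 4 / 25 * u" and u4: "u ^ 4 \<le> 8 / 125 * u"
      proof -
        show "u ^ 3 \<le> 4 / 25 * u"
          using mult_right_mono[OF u2 assms(1)] by (simp add: eval_nat_numeral)
        show "u ^ 4 \<le> 8 / 125 * u"
          using mult_right_mono[OF u2 zero_le_power2[of u]] u2u by (simp add: eval_nat_numeral)
      qed
      \<comment> \<open>Replacing the negative powers by multiples of u leaves a linear lower bound,
        with value 2 at 0 and about 1.896 at 2/5.\<close>
      have "(2 + 4 / 3 * u + u ^ 2) * (1 - 1.85 * u\<^sup>2)
          = 2 + 4 / 3 * u - 2.7 * u ^ 2 - 7.4 / 3 * u ^ 3 - 1.85 * u ^ 4"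
        by (simp add: field_simps eval_nat_numeral)
      also have "\<dots> \<ge> 1.85" using u2u u3 u4 assms by (simp add: field_simps)
      finally have "u\<^sup>2 * 1.85 \<le> u\<^sup>2 * ((2 + 4 / 3 * u + u ^ 2) * (1 - 1.85 * u\<^sup>2))"
        by (intro mult_left_mono) auto
      then have "b \<le> (2 * u ^ 2 + 4 / 3 * u ^ 3 + u ^ 4) * (1 - b)"
        by (simp add: b_def field_simps eval_nat_numeral)
      then show ?thesis using b1 by (simp add: pos_divide_le_eq)
    qed
    finally show ?thesis .
  qed
  also have "\<dots> \<le> - 4 * ln (1 - u) - 4 * u"
    using minus_ln_one_minus_ge[of u] assms by simp
  finally show ?thesis .
qed

section \<open>Cosine against the square of (1 - u) exp u for large u\<close>

lemma one_minus_times_exp_le: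
  fixes s :: real
  shows "(1 - s) * exp s \<le> 1 - s\<^sup>2 / 2 - s ^ 3 / 3"
proof -
  \<comment> \<open>The right side of the claim is the cubic Taylor polynomial at s = 0, where the
    left side is maximal. The derivative of \<open>D\<close> is s times a nonnegative factor, so
    \<open>D\<close> has its minimum at 0.\<close>
  define D where "D s = 1 - s\<^sup>2 / 2 - s ^ 3 / 3 - (1 - s) * exp s" for s :: real
  have D: "(D has_real_derivative s * (exp s - 1 - s)) (at s)" for s
    unfolding D_def by (auto intro!: derivative_eq_intros simp: algebra_simps eval_nat_numeral)
  have e: "exp s - 1 - s \<ge> 0" for s :: real using exp_ge_add_one_self[of s] by linarith
  have "D 0 \<le> D s"
  proof (cases "0 \<le> s")
    case True
    then show ?thesis
      by (rule DERIV_nonneg_imp_nondecreasing) (use D e in \<open>meson mult_nonneg_nonneg\<close>)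
  next
    case False
    then have "s \<le> 0" by simp
    then show ?thesis
      by (rule DERIV_nonpos_imp_nonincreasing) (use D e in \<open>meson mult_nonpos_nonneg\<close>)
  qed
  then show ?thesis by (simp add: D_def)
qed

lemma sin_ge_cubic:
  fixes x :: real
  assumes "0 \<le> x"
  shows "x - x ^ 3 / 6 \<le> sin x"
proof -
  have "sin 0 - (0 - 0 ^ 3 / 6) \<le> sin x - (x - x ^ 3 / 6)"
  proof (rule DERIV_nonneg_imp_nondecreasing[OF assms])
    fix w :: real
    show "\<exists>d. ((\<lambda>x. sin x - (x - x ^ 3 / 6)) has_real_derivative d) (at w) \<and> 0 \<le> d"
      using one_minus_cos_le[of w]
      by (intro exI[of _ "cos w - (1 - w\<^sup>2 / 2)"] conjI)
         (auto intro!: derivative_eq_intros)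
  qed
  then show ?thesis by simp
qed

text \<open>With v = 1 - u the right side is sin(pi v / 2), bounded below by a cubic; the left side
  is v times (exp 1 / 2) (1 - s) exp s, expanded at v = 1/2, that is s = 0. The comparison is tight:
  at u = 2/5 the sides are about 0.801 and 0.809, and at u = 3/10 it fails. Hence the five-digit
  constants.\<close>

lemma cos_ge_square_times_exp:
  fixes u :: real
  assumes "2 / 5 \<le> u" "u \<le> 1"
  shows "(1 - u)\<^sup>2 * exp (2 * u) \<le> cos (pi * u / 2)"
proof -
  define v where "v = 1 - u"
  define s where "s = 1 - 2 * v"
  have v: "0 \<le> v" "v \<le> 3 / 5" using assms by (auto simp: v_def)
  have e: "exp 1 / 2 \<le> (1.35915 :: real)"
    using e_approx_32 by (simp add: abs_if split: if_splits)
  have p3: "pi ^ 3 / 48 \<le> 0.64597"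
  proof -
    have "pi ^ 3 \<le> 3.1415927 ^ 3" using pi_approx by (intro power_mono) auto
    then show ?thesis by (simp add: eval_nat_numeral)
  qed
  have "exp (2 * u) = exp 1 * exp s"
    unfolding exp_add[symmetric] by (simp add: s_def v_def)
  then have "(1 - u)\<^sup>2 * exp (2 * u) = v * (exp 1 / 2 * ((1 - s) * exp s))"
    by (simp add: s_def power2_eq_square v_def)
  also have "\<dots> \<le> v * (exp 1 / 2 * (1 - s\<^sup>2 / 2 - s ^ 3 / 3))"
    using v one_minus_times_exp_le[of s] by (intro mult_left_mono) auto
  also have "\<dots> \<le> v * (1.35915 * (1 - s\<^sup>2 / 2 - s ^ 3 / 3))"
  proof -
    have "0 \<le> (1 - s) * exp s" using v by (simp add: s_def)
    then have "0 \<le> 1 - s\<^sup>2 / 2 - s ^ 3 / 3"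
      using one_minus_times_exp_le[of s] by linarith
    then show ?thesis using v e by (intro mult_left_mono mult_right_mono) auto
  qed
  also have "\<dots> \<le> v * (1.57079 - 0.64597 * v\<^sup>2)"
  proof -
    \<comment> \<open>After division by v, right side minus left side is a cubic with value about
      0.00265 at v = 3/5. Lowering its constant term by that value makes 3/5 a root, and this
      quadratic is the cofactor of 0.6 - v.\<close>
    have "0 \<le> (3.6244 * v\<^sup>2 - 5.33429 * v + 2.236026 :: real)"
    proof -
      have "0 \<le> 3.6244 * (v - 0.7358)\<^sup>2" by simp
      then show ?thesis using v by (simp add: power2_eq_square algebra_simps)
    qed
    then have "0 \<le> (0.6 - v) * (3.6244 * v\<^sup>2 - 5.33429 * v + 2.236026)"
      using v by simp
    also have "\<dots> = 1.3416156 - 5.4366 * v + 7.50893 * v\<^sup>2 - 3.6244 * v ^ 3"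
      by (simp add: power2_eq_square power3_eq_cube field_simps)
    finally have "0 \<le> 1.3416156 - 5.4366 * v + 7.50893 * v\<^sup>2 - 3.6244 * v ^ 3" .
    moreover have "1 - s\<^sup>2 / 2 - s ^ 3 / 3 = 1 / 6 + 4 * v - 6 * v\<^sup>2 + 8 / 3 * v ^ 3"
      by (simp add: s_def power2_eq_square power3_eq_cube field_simps)
    moreover have "0 \<le> v\<^sup>2" "0 \<le> v ^ 3" "v\<^sup>2 \<le> 9/25" "v ^ 3 \<le> 27/125"
      using v power_mono[OF v(2,1), of 2] power_mono[OF v(2,1), of 3] by (auto simp: eval_nat_numeral)
    ultimately have "1.35915 * (1 - s\<^sup>2 / 2 - s ^ 3 / 3) \<le> 1.57079 - 0.64597 * v\<^sup>2"
      using v by simp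
    then show ?thesis using v by (intro mult_left_mono) auto
  qed
  also have "\<dots> \<le> v * (pi / 2 - pi ^ 3 / 48 * v\<^sup>2)"
  proof -
    have "pi ^ 3 / 48 * v\<^sup>2 \<le> 0.64597 * v\<^sup>2" using p3 by (intro mult_right_mono) auto
    moreover have "1.57079 \<le> pi / 2" using pi_approx by simp
    ultimately show ?thesis using v by (intro mult_left_mono) auto
  qed
  also have "\<dots> = pi * v / 2 - (pi * v / 2) ^ 3 / 6"
    by (simp add: field_simps eval_nat_numeral)
  also have "\<dots> \<le> sin (pi * v / 2)" using v by (intro sin_ge_cubic) auto
  also have "\<dots> = cos (pi * u / 2)"
    by (simp add: sin_cos_eq v_def algebra_simps diff_divide_distrib)
  finally show ?thesis .
qed

section \<open>Exponential moments of Lipschitz functions on the line\<close>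

lemma sinh_ge_self:
  fixes y :: real
  assumes "0 \<le> y"
  shows "y \<le> sinh y"
proof -
  have "sinh 0 - 0 \<le> sinh y - y"
    by (rule DERIV_nonneg_imp_nondecreasing[OF assms])
       (auto intro!: derivative_eq_intros exI simp: cosh_real_ge_1)
  then show ?thesis by simp
qed

text \<open>The linear term is kept on the left because it integrates to a known mean. Negative w
  reduce to positive ones: exp w - w <= exp |w| - |w| amounts to |w| <= sinh |w|.\<close>

lemma exp_minus_le_cosh:
  fixes w b :: real
  assumes "\<bar>w\<bar> \<le> \<bar>b\<bar>"
  shows "exp w - w \<le> cosh (11 / 9 * b)"
proof -
  have "exp w - w \<le> exp \<bar>w\<bar> - \<bar>w\<bar>"
  proof (cases "0 \<le> w")
    case False
    then show ?thesis using sinh_ge_self[of "- w"] by (simp add: sinh_def)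
  qed simp
  also have "\<dots> \<le> cosh (11 / 9 * \<bar>w\<bar>)" using exp_le_cosh_add[of "\<bar>w\<bar>"] by simp
  also have "\<dots> \<le> cosh (11 / 9 * \<bar>b\<bar>)" using assms by (subst cosh_real_nonneg_le_iff) auto
  also have "\<dots> = cosh (11 / 9 * b)" by (simp add: abs_if)
  finally show ?thesis .
qed

lemma lipschitz_continuous_on:
  fixes F :: "real \<Rightarrow> real"
  assumes "\<And>a b. \<bar>F a - F b\<bar> \<le> k * \<bar>a - b\<bar>"
  shows "continuous_on UNIV F"
proof -
  have "0 \<le> k" using assms[of 0 1] by simp
  then have "k-lipschitz_on UNIV F"
    using assms by (intro lipschitz_onI) (auto simp: dist_real_def)
  then show ?thesis by (rule lipschitz_on_continuous_on)
qed

text \<open>The bound 1 / cos(v T / 2) is the moment generating function of the hyperbolic secant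
  law, with density sech(pi s / T) / T. It is imposed on a nonnegative integral, so that
  integrability of the exponentials in the open strip is a consequence.\<close>

locale sech_tail = prob_space N for N :: "real measure" +
  fixes T :: real
  assumes sets_N [measurable_cong]: "sets N = sets borel"
    and T_pos: "0 < T"
    and nn_mgf: "\<And>v. \<bar>v\<bar> < pi / T \<Longrightarrow> (\<integral>\<^sup>+s. ennreal (exp (v * s)) \<partial>N) \<le> ennreal (1 / cos (v * T / 2))"
begin

lemma cos_pos:
  assumes "\<bar>v\<bar> < pi / T"
  shows "0 < cos (v * T / 2)"
proof -
  have "\<bar>v * T\<bar> < pi" using assms T_pos by (simp add: abs_mult field_simps)
  then show ?thesis by (intro cos_gt_zero_pi) auto
qed

lemma integrable_exp:
  assumes "\<bar>v\<bar> < pi / T"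
  shows "integrable N (\<lambda>s. exp (v * s))"
  by (rule integrableI_nonneg)
     (use nn_mgf[OF assms] in \<open>auto simp: less_top[symmetric] top_unique intro: le_less_trans\<close>)

lemma mgf_le:
  assumes "\<bar>v\<bar> < pi / T"
  shows "(\<integral>s. exp (v * s) \<partial>N) \<le> 1 / cos (v * T / 2)"
proof -
  have "ennreal (\<integral>s. exp (v * s) \<partial>N) = (\<integral>\<^sup>+s. ennreal (exp (v * s)) \<partial>N)"
    by (intro nn_integral_eq_integral[symmetric] integrable_exp assms) auto
  also have "\<dots> \<le> ennreal (1 / cos (v * T / 2))" by (rule nn_mgf[OF assms])
  finally show ?thesis using cos_pos[OF assms] by (simp add: ennreal_le_iff)
qed

lemma integrable_cosh_sinh:
  assumes "\<bar>v\<bar> < pi / T"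
  shows "integrable N (\<lambda>s. cosh (v * s))" "integrable N (\<lambda>s. sinh (v * s))"
  using integrable_exp[OF assms] integrable_exp[of "- v"] assms
  by (auto simp: cosh_def sinh_def)

lemma integral_cosh_le:
  assumes "\<bar>v\<bar> < pi / T"
  shows "(\<integral>s. cosh (v * s) \<partial>N) \<le> 1 / cos (v * T / 2)"
proof -
  have "(\<integral>s. cosh (v * s) \<partial>N) = ((\<integral>s. exp (v * s) \<partial>N) + (\<integral>s. exp (- v * s) \<partial>N)) / 2"
    using integrable_exp[OF assms] integrable_exp[of "- v"] assms by (simp add: cosh_def)
  then show ?thesis using mgf_le[OF assms] mgf_le[of "- v"] assms by simp
qed

lemma integrable_abs: "integrable N (\<lambda>s. \<bar>s\<bar>)"
proof -
  define v where "v = pi / T / 2"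
  have v: "0 < v" "\<bar>v\<bar> < pi / T" using T_pos by (auto simp: v_def field_simps)
  show ?thesis
  proof (rule Bochner_Integration.integrable_bound)
    show "integrable N (\<lambda>s. 2 / v * cosh (v * s))" using integrable_cosh_sinh[OF v(2)] by simp
    show "AE s in N. norm \<bar>s\<bar> \<le> norm (2 / v * cosh (v * s))"
    proof (rule AE_I2)
      fix s
      have "v * \<bar>s\<bar> \<le> exp (v * \<bar>s\<bar>)" using exp_ge_add_one_self[of "v * \<bar>s\<bar>"] by linarith
      also have "\<dots> \<le> 2 * cosh (v * \<bar>s\<bar>)" by (simp add: cosh_def)
      also have "cosh (v * \<bar>s\<bar>) = cosh (v * s)" by (simp add: abs_if)
      finally show "norm \<bar>s\<bar> \<le> norm (2 / v * cosh (v * s))"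
        using v by (simp add: field_simps)
    qed
  qed measurable
qed

context
  fixes F :: "real \<Rightarrow> real" and k :: real
  assumes lip: "\<And>a b. \<bar>F a - F b\<bar> \<le> k * \<bar>a - b\<bar>"
begin

lemma measurable_lipschitz: "F \<in> borel_measurable N"
  using borel_measurable_continuous_onI[OF lipschitz_continuous_on[OF lip]]
  by (simp add: measurable_cong_sets[OF sets_N refl])

lemma integrable_lipschitz: "integrable N F"
proof (rule Bochner_Integration.integrable_bound)
  show "integrable N (\<lambda>s. \<bar>F 0\<bar> + k * \<bar>s\<bar>)" using integrable_abs by simp
  show "AE s in N. norm (F s) \<le> norm (\<bar>F 0\<bar> + k * \<bar>s\<bar>)"
    using lip[of _ 0] by (intro AE_I2) (smt (verit) real_norm_def diff_0_right)
qed (rule measurable_lipschitz)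

lemma integrable_exp_lipschitz:
  assumes "\<bar>k\<bar> < pi / T"
  shows "integrable N (\<lambda>s. exp (F s))"
proof (rule Bochner_Integration.integrable_bound)
  show "integrable N (\<lambda>s. exp (F 0) * (2 * cosh (k * s)))"
    using integrable_cosh_sinh[OF assms] by simp
  show "(\<lambda>s. exp (F s)) \<in> borel_measurable N" using measurable_lipschitz by measurable
  show "AE s in N. norm (exp (F s)) \<le> norm (exp (F 0) * (2 * cosh (k * s)))"
  proof (rule AE_I2)
    fix s
    have "F s \<le> F 0 + k * \<bar>s\<bar>" using lip[of s 0] by simp
    then have "exp (F s) \<le> exp (F 0) * exp (k * \<bar>s\<bar>)" by (simp flip: exp_add)
    also have "\<dots> \<le> exp (F 0) * (2 * cosh (k * \<bar>s\<bar>))" by (simp add: cosh_def)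
    also have "cosh (k * \<bar>s\<bar>) = cosh (k * s)" by (simp add: abs_if)
    finally show "norm (exp (F s)) \<le> norm (exp (F 0) * (2 * cosh (k * s)))" by simp
  qed
qed

end

text \<open>Symmetrization: with an independent copy t of s,
  \<open>E exp(F - E F) \<le> E cosh(F s - F t) \<le> E cosh(k (s - t)) \<le> (E cosh(k s))\<^sup>2\<close>.\<close>

lemma exp_lipschitz_le_cosh_squared:
  fixes F :: "real \<Rightarrow> real"
  assumes lip: "\<And>a b. \<bar>F a - F b\<bar> \<le> k * \<bar>a - b\<bar>" and k: "\<bar>k\<bar> < pi / T"
  shows "(\<integral>s. exp (F s - (\<integral>t. F t \<partial>N)) \<partial>N) \<le> (\<integral>s. cosh (k * s) \<partial>N)\<^sup>2"
proof -
  define m where "m = (\<integral>t. F t \<partial>N)"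
  define G where "G s = F s - m" for s
  have lipG: "\<bar>G a - G b\<bar> \<le> k * \<bar>a - b\<bar>" "\<bar>- G a - - G b\<bar> \<le> k * \<bar>a - b\<bar>" for a b
    using lip[of a b] by (auto simp: G_def abs_if split: if_splits)
  have I: "integrable N (\<lambda>s. exp (G s))" "integrable N (\<lambda>s. exp (- G s))" "integrable N G"
    using integrable_exp_lipschitz[OF lipG(1) k] integrable_exp_lipschitz[OF lipG(2) k]
      integrable_lipschitz[OF lipG(1)] by auto
  define P where "P = (\<integral>s. exp (G s) \<partial>N)"
  define Q where "Q = (\<integral>s. exp (- G s) \<partial>N)"
  define Ch where "Ch = (\<integral>s. cosh (k * s) \<partial>N)"
  define Sh where "Sh = (\<integral>s. sinh (k * s) \<partial>N)"
  note CS = integrable_cosh_sinh[OF k]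
  have "(\<integral>s. G s \<partial>N) = 0"
    unfolding G_def m_def using integrable_lipschitz[OF lip] by (simp add: prob_space)
  \<comment> \<open>Jensen's inequality for the centred \<open>G\<close>. It permits multiplying
    \<open>P\<close> by \<open>Q\<close>, which brings in the independent copy.\<close>
  then have "1 = (\<integral>s. 1 - G s \<partial>N)" using I by (simp add: prob_space)
  also have "\<dots> \<le> Q" unfolding Q_def
    using I exp_ge_add_one_self[of "- G _"] by (intro integral_mono) auto
  finally have Q1: "1 \<le> Q" .
  have P0: "0 \<le> P" unfolding P_def by simp
  \<comment> \<open>The addition theorem for cosh separates s from t, so the average over both
    variables is taken by two successive single integrals, without a product measure.\<close>
  have pw: "(exp (G s) * exp (- G t) + exp (- G s) * exp (G t)) / 2
      \<le> cosh (k * s) * cosh (k * t) - sinh (k * s) * sinh (k * t)" for s t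
  proof -
    have "(exp (G s) * exp (- G t) + exp (- G s) * exp (G t)) / 2 = cosh \<bar>G s - G t\<bar>"
      by (simp add: cosh_def abs_if flip: exp_add)
    also have "\<dots> \<le> cosh \<bar>k * (s - t)\<bar>"
    proof (subst cosh_real_nonneg_le_iff)
      show "\<bar>G s - G t\<bar> \<le> \<bar>k * (s - t)\<bar>"
        using lipG(1)[of s t] by (simp add: abs_mult) (smt (verit) mult_right_mono abs_ge_self abs_ge_zero)
    qed auto
    also have "\<dots> = cosh (k * s - k * t)" by (simp add: algebra_simps)
    finally show ?thesis by (simp add: cosh_diff)
  qed
  have "(exp (G s) * Q + exp (- G s) * P) / 2 \<le> cosh (k * s) * Ch - sinh (k * s) * Sh" for s
  proof -
    have "(exp (G s) * Q + exp (- G s) * P) / 2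
        = (\<integral>t. (exp (G s) * exp (- G t) + exp (- G s) * exp (G t)) / 2 \<partial>N)"
      using I by (simp add: P_def Q_def)
    also have "\<dots> \<le> (\<integral>t. cosh (k * s) * cosh (k * t) - sinh (k * s) * sinh (k * t) \<partial>N)"
      using I CS pw by (intro integral_mono) auto
    also have "\<dots> = cosh (k * s) * Ch - sinh (k * s) * Sh"
      using CS by (simp add: Ch_def Sh_def)
    finally show ?thesis .
  qed
  then have le: "(\<integral>s. (exp (G s) * Q + exp (- G s) * P) / 2 \<partial>N)
      \<le> (\<integral>s. cosh (k * s) * Ch - sinh (k * s) * Sh \<partial>N)"
    using I CS by (intro integral_mono) auto
  have "P * Q \<le> Ch\<^sup>2 - Sh\<^sup>2"
  proof -
    have "(\<integral>s. (exp (G s) * Q + exp (- G s) * P) / 2 \<partial>N) = (P * Q + Q * P) / 2"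
      using I by (simp add: P_def[symmetric] Q_def[symmetric])
    moreover have "(\<integral>s. cosh (k * s) * Ch - sinh (k * s) * Sh \<partial>N) = Ch * Ch - Sh * Sh"
      using CS by (simp add: Ch_def[symmetric] Sh_def[symmetric])
    ultimately show ?thesis using le by (simp add: power2_eq_square)
  qed
  moreover have "P * 1 \<le> P * Q" using P0 Q1 by (intro mult_left_mono)
  ultimately have "P \<le> Ch\<^sup>2" using zero_le_power2[of Sh] by linarith
  then show ?thesis by (simp add: P_def Ch_def G_def m_def)
qed

text \<open>For small k the loss of a factor 2 in the variance incurred by symmetrization is too large.
  Centring at \<open>F 0\<close> instead and using \<open>ln y \<le> y - 1\<close> avoids it.\<close>

lemma exp_lipschitz_le_exp_cosh:
  fixes F :: "real \<Rightarrow> real"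
  assumes lip: "\<And>a b. \<bar>F a - F b\<bar> \<le> k * \<bar>a - b\<bar>" and k: "\<bar>11 / 9 * k\<bar> < pi / T"
  shows "(\<integral>s. exp (F s - (\<integral>t. F t \<partial>N)) \<partial>N) \<le> exp ((\<integral>s. cosh (11 / 9 * k * s) \<partial>N) - 1)"
proof -
  define m where "m = (\<integral>t. F t \<partial>N)"
  define W where "W s = F s - F 0" for s
  have "\<bar>11 / 9 * k\<bar> = 11 / 9 * \<bar>k\<bar>" by (simp add: abs_mult)
  then have k': "\<bar>k\<bar> < pi / T" using k by linarith
  have lipW: "\<bar>W a - W b\<bar> \<le> k * \<bar>a - b\<bar>" for a b
    using lip[of a b] by (simp add: W_def)
  note I = integrable_exp_lipschitz[OF lipW k'] integrable_lipschitz[OF lipW]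
  have w: "(\<integral>s. W s \<partial>N) = m - F 0"
    unfolding W_def m_def using integrable_lipschitz[OF lip] by (simp add: prob_space)
  \<comment> \<open>Subtracting the mean of \<open>W\<close> removes the linear term before absolute
    values are taken. It comes back inside 1 + y <= exp y as a factor exp (m - F 0), which the
    centring at m cancels at the end.\<close>
  have "(\<integral>s. exp (W s) \<partial>N) - (m - F 0) = (\<integral>s. exp (W s) - W s \<partial>N)"
    using I w by simp
  also have "\<dots> \<le> (\<integral>s. cosh (11 / 9 * k * s) \<partial>N)"
  proof (rule integral_mono)
    show "integrable N (\<lambda>s. cosh (11 / 9 * k * s))" using integrable_cosh_sinh[OF k] by simp
    fix s
    have "\<bar>W s\<bar> \<le> k * \<bar>s\<bar>" using lip[of s 0] by (simp add: W_def)
    then have "\<bar>W s\<bar> \<le> \<bar>k * s\<bar>" by (simp add: abs_mult) (smt (verit) mult_right_mono abs_ge_self abs_ge_zero)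
    then show "exp (W s) - W s \<le> cosh (11 / 9 * k * s)"
      using exp_minus_le_cosh[of "W s" "k * s"] by (simp add: mult.assoc)
  qed (use I in auto)
  finally have "(\<integral>s. exp (W s) \<partial>N) \<le> 1 + ((\<integral>s. cosh (11 / 9 * k * s) \<partial>N) - 1 + (m - F 0))" by simp
  also have "\<dots> \<le> exp ((\<integral>s. cosh (11 / 9 * k * s) \<partial>N) - 1 + (m - F 0))" by (rule exp_ge_add_one_self)
  finally have *: "(\<integral>s. exp (W s) \<partial>N) \<le> exp ((\<integral>s. cosh (11 / 9 * k * s) \<partial>N) - 1 + (m - F 0))" .
  have "(\<integral>s. exp (F s - m) \<partial>N) = (\<integral>s. exp (F 0 - m) * exp (W s) \<partial>N)"
    by (simp add: W_def flip: exp_add)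
  also have "\<dots> = exp (F 0 - m) * (\<integral>s. exp (W s) \<partial>N)" by simp
  also have "\<dots> \<le> exp (F 0 - m) * exp ((\<integral>s. cosh (11 / 9 * k * s) \<partial>N) - 1 + (m - F 0))"
    using * by (intro mult_left_mono) auto
  also have "\<dots> = exp ((\<integral>s. cosh (11 / 9 * k * s) \<partial>N) - 1)" by (simp flip: exp_add)
  finally show ?thesis by (simp add: m_def)
qed

text \<open>The Lipschitz constant is measured by u, so that u < 1 is the strip in which exponential
  moments are controlled. Up to u = 2/5 the stretched value 11/9 * u is at most 22/45 and stays
  inside it.\<close>

lemma exp_lipschitz_le:
  fixes F :: "real \<Rightarrow> real"
  assumes lip: "\<And>a b. \<bar>F a - F b\<bar> \<le> u * pi / T * \<bar>a - b\<bar>" and u: "0 \<le> u" "u < 1"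
  shows "(\<integral>s. exp (F s - (\<integral>t. F t \<partial>N)) \<partial>N) \<le> exp (- 4 * u) / (1 - u) ^ 4"
proof (cases "u \<le> 2 / 5")
  case True
  have k: "\<bar>11 / 9 * (u * pi / T)\<bar> < pi / T"
  proof -
    have "11 / 9 * u * (pi / T) < 1 * (pi / T)"
      using True T_pos by (intro mult_strict_right_mono) auto
    then show ?thesis using u T_pos by (simp add: abs_mult)
  qed
  have "(\<integral>s. exp (F s - (\<integral>t. F t \<partial>N)) \<partial>N)
      \<le> exp ((\<integral>s. cosh (11 / 9 * (u * pi / T) * s) \<partial>N) - 1)"
    by (rule exp_lipschitz_le_exp_cosh[OF lip k])
  also have "\<dots> \<le> exp (1 / cos (11 / 9 * (pi * u / 2)) - 1)"
    using integral_cosh_le[OF k] T_pos by (simp add: mult.commute)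
  also have "\<dots> \<le> exp (- 4 * ln (1 - u) - 4 * u)"
    using inverse_cos_le[OF u(1) True] by (simp only: exp_le_cancel_iff)
  also have "\<dots> = exp (- 4 * u) / exp (real 4 * ln (1 - u))" by (simp flip: exp_diff)
  also have "\<dots> = exp (- 4 * u) / (1 - u) ^ 4"
    using u by (simp only: exp_of_nat_mult exp_ln)
  finally show ?thesis .
next
  case False
  have k: "\<bar>u * pi / T\<bar> < pi / T"
    using u T_pos by (simp add: abs_mult divide_strict_right_mono)
  have c: "(1 - u)\<^sup>2 * exp (2 * u) \<le> cos (pi * u / 2)"
    using False u by (intro cos_ge_square_times_exp) auto
  have "(\<integral>s. exp (F s - (\<integral>t. F t \<partial>N)) \<partial>N) \<le> (\<integral>s. cosh (u * pi / T * s) \<partial>N)\<^sup>2"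
    by (rule exp_lipschitz_le_cosh_squared[OF lip k])
  also have "\<dots> \<le> (1 / cos (u * pi / T * T / 2))\<^sup>2"
    by (intro power_mono integral_cosh_le k integral_nonneg) auto
  also have "\<dots> = (1 / cos (pi * u / 2))\<^sup>2" using T_pos by (simp add: mult.commute)
  also have "\<dots> \<le> (1 / ((1 - u)\<^sup>2 * exp (2 * u)))\<^sup>2"
  proof -
    have pos: "0 < (1 - u)\<^sup>2 * exp (2 * u)" using u by simp
    with c show ?thesis by (intro power_mono frac_le) auto
  qed
  also have "\<dots> = 1 / ((1 - u) ^ 4 * exp (4 * u))"
    by (simp add: power_divide power_mult_distrib flip: power_mult exp_of_nat_mult)
  also have "\<dots> = exp (- 4 * u) / (1 - u) ^ 4" by (simp add: exp_minus field_simps)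
  finally show ?thesis .
qed

end

section \<open>Tensorization and the Chernoff bound\<close>

text \<open>The Lipschitz hypothesis ranges over all functions, not only the extensional ones that
  make up the product space; \<open>G\<close> therefore ignores coordinates outside
  \<open>A\<close>. This makes \<open>G\<close> constant for empty \<open>A\<close> and lets the
  bound be applied to any x(i := a).\<close>

lemma lipschitz_exp_tensorization:
  fixes D :: "'i \<Rightarrow> real measure" and G :: "('i \<Rightarrow> real) \<Rightarrow> real"
  assumes D: "\<And>i. sech_tail (D i) T" and u: "0 \<le> u" "u < 1"
    and "finite A" "G \<in> borel_measurable (PiM A D)"
    and "\<And>x y. \<bar>G x - G y\<bar> \<le> u * pi / T * (\<Sum>i\<in>A. \<bar>x i - y i\<bar>)"
  shows "integrable (PiM A D) G \<and>
    (\<integral>\<^sup>+x. ennreal (exp (G x - (\<integral>y. G y \<partial>PiM A D))) \<partial>PiM A D)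
      \<le> ennreal ((exp (- 4 * u) / (1 - u) ^ 4) ^ card A)"
  using assms(4-6)
proof (induction A arbitrary: G rule: finite_induct)
  interpret D: sech_tail "D i" T for i by (rule D)
  interpret product_prob_space D ..
  case (empty G)
  have "G = (\<lambda>_. G (\<lambda>_. undefined))"
    using empty(2)[of _ "\<lambda>_. undefined"] by (auto simp: fun_eq_iff)
  then show ?case by (auto simp: PiM_empty nn_integral_count_space_finite integrable_count_space lebesgue_integral_count_space_finite)
next
  interpret D: sech_tail "D i" T for i by (rule D)
  interpret product_prob_space D ..
  define \<kappa> where "\<kappa> = u * pi / T"
  have \<kappa>: "0 \<le> \<kappa>" using u D.T_pos by (simp add: \<kappa>_def)
  define K where "K = exp (- 4 * u) / (1 - u) ^ 4"
  have K: "0 \<le> K" using u by (simp add: K_def)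
  case (insert i A G)
  note G [measurable] = insert.prems(1)
  have lip: "\<bar>G x - G y\<bar> \<le> \<kappa> * (\<bar>x i - y i\<bar> + (\<Sum>i\<in>A. \<bar>x i - y i\<bar>))" for x y
    using insert.prems(2)[of x y] insert.hyps by (simp add: \<kappa>_def)
  interpret A: prob_space "PiM A D" by (rule prob_space_PiM) (rule D.prob_space_axioms)
  interpret iA: prob_space "PiM (insert i A) D" by (rule prob_space_PiM) (rule D.prob_space_axioms)

  have lip1: "\<bar>G (x(i := a)) - G (x(i := b))\<bar> \<le> \<kappa> * \<bar>a - b\<bar>" for x a b
  proof -
    have "(\<Sum>j\<in>A. \<bar>(x(i := a)) j - (x(i := b)) j\<bar>) = 0"
      using insert.hyps by (intro sum.neutral) auto
    then show ?thesis using lip[of "x(i := a)" "x(i := b)"] by simp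
  qed
  have int1: "integrable (D i) (\<lambda>a. G (x(i := a)))" for x
    by (rule D.integrable_lipschitz[OF lip1])
  define H where "H x = (\<integral>a. G (x(i := a)) \<partial>D i)" for x
  have [measurable]: "H \<in> borel_measurable (PiM A D)"
    unfolding H_def by measurable
  have "\<bar>H x - H y\<bar> \<le> u * pi / T * (\<Sum>i\<in>A. \<bar>x i - y i\<bar>)" for x y
  proof -
    have "\<bar>H x - H y\<bar> = \<bar>\<integral>a. G (x(i := a)) - G (y(i := a)) \<partial>D i\<bar>"
      unfolding H_def using int1 by simp
    also have "\<dots> \<le> (\<integral>a. \<bar>G (x(i := a)) - G (y(i := a))\<bar> \<partial>D i)"
      by (rule integral_abs_bound)
    also have "\<dots> \<le> (\<integral>a. \<kappa> * (\<Sum>i\<in>A. \<bar>x i - y i\<bar>) \<partial>D i)"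
    proof (rule integral_mono)
      fix a
      have "(\<Sum>j\<in>A. \<bar>(x(i := a)) j - (y(i := a)) j\<bar>) = (\<Sum>j\<in>A. \<bar>x j - y j\<bar>)"
        using insert.hyps by (intro sum.cong) auto
      then show "\<bar>G (x(i := a)) - G (y(i := a))\<bar> \<le> \<kappa> * (\<Sum>i\<in>A. \<bar>x i - y i\<bar>)"
        using lip[of "x(i := a)" "y(i := a)"] by simp
    qed (use int1 in auto)
    also have "\<dots> = \<kappa> * (\<Sum>i\<in>A. \<bar>x i - y i\<bar>)" by (simp add: D.prob_space)
    finally show ?thesis by (simp add: \<kappa>_def)
  qed
  then have IH: "integrable (PiM A D) H"
      "(\<integral>\<^sup>+x. ennreal (exp (H x - (\<integral>y. H y \<partial>PiM A D))) \<partial>PiM A D) \<le> ennreal (K ^ card A)"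
    using insert.IH[of H] by (auto simp: K_def)

  have intG: "integrable (PiM (insert i A) D) G"
  proof (rule Bochner_Integration.integrable_bound)
    have "integrable (PiM (insert i A) D) (\<lambda>x. \<bar>x j\<bar>)" if "j \<in> insert i A" for j
    proof -
      have "distr (PiM (insert i A) D) (D j) (\<lambda>x. x j) = D j"
        using insert.hyps that D.prob_space_axioms by (intro distr_PiM_component) auto
      then show ?thesis
        using D.integrable_abs[of j] that
          integrable_distr[of "\<lambda>x. x j" "PiM (insert i A) D" "D j" abs] by simp
    qed
    then show "integrable (PiM (insert i A) D) (\<lambda>x. \<bar>G (\<lambda>_. 0)\<bar> + \<kappa> * (\<bar>x i\<bar> + (\<Sum>i\<in>A. \<bar>x i\<bar>)))"
      by (intro Bochner_Integration.integrable_add integrable_mult_right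
          Bochner_Integration.integrable_sum) auto
    show "AE x in PiM (insert i A) D. norm (G x) \<le> norm (\<bar>G (\<lambda>_. 0)\<bar> + \<kappa> * (\<bar>x i\<bar> + (\<Sum>i\<in>A. \<bar>x i\<bar>)))"
      using lip[of _ "\<lambda>_. 0"] by (intro AE_I2) (simp, smt (verit))
  qed (rule G)

  have m: "(\<integral>y. G y \<partial>PiM (insert i A) D) = (\<integral>y. H y \<partial>PiM A D)"
    unfolding H_def using insert.hyps intG by (rule product_integral_insert)
  define m where "m = (\<integral>y. H y \<partial>PiM A D)"
  have "(\<integral>\<^sup>+x. ennreal (exp (G x - m)) \<partial>PiM (insert i A) D)
      = (\<integral>\<^sup>+x. (\<integral>\<^sup>+a. ennreal (exp (G (x(i := a)) - m)) \<partial>D i) \<partial>PiM A D)"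
    using insert.hyps by (intro product_nn_integral_insert) auto
  also have "\<dots> \<le> (\<integral>\<^sup>+x. ennreal K * ennreal (exp (H x - m)) \<partial>PiM A D)"
  proof (rule nn_integral_mono)
    fix x
    \<comment> \<open>Splitting exp (G - m) into exp (G - H x) and exp (H x - m) centres the inner
      integrand at its own mean \<open>H x\<close>, so the one-coordinate bound applies with the
      same \<open>K\<close> for every x.\<close>
    have lip2: "\<bar>(G (x(i := a)) - H x) - (G (x(i := b)) - H x)\<bar> \<le> \<kappa> * \<bar>a - b\<bar>" for a b
      using lip1[of x a b] by simp
    have "\<kappa> < pi / T" using u D.T_pos by (simp add: \<kappa>_def divide_strict_right_mono)
    then have I: "integrable (D i) (\<lambda>a. exp (G (x(i := a)) - H x))"
      using \<kappa> by (intro D.integrable_exp_lipschitz[OF lip2]) auto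
    have [measurable]: "(\<lambda>a. G (x(i := a))) \<in> borel_measurable (D i)"
      using int1 by auto
    have "(\<integral>\<^sup>+a. ennreal (exp (G (x(i := a)) - m)) \<partial>D i)
        = (\<integral>\<^sup>+a. ennreal (exp (H x - m)) * ennreal (exp (G (x(i := a)) - H x)) \<partial>D i)"
      by (simp flip: ennreal_mult' exp_add)
    also have "\<dots> = ennreal (exp (H x - m)) * (\<integral>\<^sup>+a. ennreal (exp (G (x(i := a)) - H x)) \<partial>D i)"
      by (rule nn_integral_cmult) measurable
    also have "(\<integral>\<^sup>+a. ennreal (exp (G (x(i := a)) - H x)) \<partial>D i) = ennreal (\<integral>a. exp (G (x(i := a)) - H x) \<partial>D i)"
      using I by (intro nn_integral_eq_integral) auto
    also have "ennreal (exp (H x - m)) * \<dots> \<le> ennreal (exp (H x - m)) * ennreal K"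
      unfolding H_def K_def
      using D.exp_lipschitz_le[of "\<lambda>a. G (x(i := a))" u i] lip1 u
      by (intro mult_left_mono ennreal_leI) (auto simp: \<kappa>_def)
    finally show "(\<integral>\<^sup>+a. ennreal (exp (G (x(i := a)) - m)) \<partial>D i) \<le> ennreal K * ennreal (exp (H x - m))"
      by (simp only: mult.commute)
  qed
  also have "\<dots> = ennreal K * (\<integral>\<^sup>+x. ennreal (exp (H x - m)) \<partial>PiM A D)"
    by (rule nn_integral_cmult) measurable
  also have "\<dots> \<le> ennreal K * ennreal (K ^ card A)"
    using IH(2) by (intro mult_left_mono) (auto simp: m_def)
  also have "\<dots> = ennreal (K ^ card (insert i A))"
    using insert.hyps K by (simp add: ennreal_mult')
  finally show ?case using intG m by (simp add: K_def m_def)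
qed

lemma (in prob_space) chernoff_bound:
  assumes "Y \<in> borel_measurable M" and "(\<integral>\<^sup>+\<omega>. ennreal (exp (l * Y \<omega>)) \<partial>M) \<le> ennreal C" "0 < l" "0 \<le> C"
  shows "prob {\<omega> \<in> space M. x \<le> Y \<omega>} \<le> exp (- (l * x)) * C"
proof -
  have [measurable]: "Y \<in> borel_measurable M" by fact
  have "emeasure M {\<omega> \<in> space M. x \<le> Y \<omega>}
      \<le> emeasure M ({\<omega> \<in> space M. 1 \<le> ennreal (exp (- (l * x))) * ennreal (exp (l * Y \<omega>))} \<inter> space M)"
  proof (rule emeasure_mono)
    have "1 \<le> ennreal (exp (- (l * x))) * ennreal (exp (l * Y \<omega>))" if "x \<le> Y \<omega>" for \<omega>
      using that assms(3) by (simp add: mult_left_mono flip: ennreal_mult' exp_add ennreal_1)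
    then show "{\<omega> \<in> space M. x \<le> Y \<omega>}
        \<subseteq> {\<omega> \<in> space M. 1 \<le> ennreal (exp (- (l * x))) * ennreal (exp (l * Y \<omega>))} \<inter> space M"
      by auto
  qed measurable
  also have "\<dots> \<le> ennreal (exp (- (l * x))) * (\<integral>\<^sup>+\<omega>. ennreal (exp (l * Y \<omega>)) * indicator (space M) \<omega> \<partial>M)"
    using nn_integral_Markov_inequality[of "\<lambda>\<omega>. ennreal (exp (l * Y \<omega>))" "space M" M "ennreal (exp (- (l * x)))"]
    by (simp add: Int_def conj_commute cong: conj_cong)
  also have "\<dots> \<le> ennreal (exp (- (l * x))) * ennreal C"
    using assms(2) by (intro mult_left_mono) (auto cong: nn_integral_cong)
  also have "\<dots> = ennreal (exp (- (l * x)) * C)" by (simp add: ennreal_mult')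
  finally show ?thesis using assms(4) by (simp add: emeasure_eq_measure)
qed

lemma (in prob_space) lipschitz_concentration:
  fixes S :: "'n::finite \<Rightarrow> 'a \<Rightarrow> real" and g :: "real ^ 'n \<Rightarrow> real" and c T x :: real
  assumes "0 < c" "0 < T" "0 < x"
    and lip: "\<And>u v. \<bar>g u - g v\<bar> \<le> c * (\<Sum>i\<in>UNIV. \<bar>u $ i - v $ i\<bar>)"
    and indep: "indep_vars (\<lambda>_. borel) S UNIV"
    and mgf: "\<And>i v. \<bar>v\<bar> < pi / T \<Longrightarrow>
      (\<integral>\<^sup>+\<omega>. ennreal (exp (v * S i \<omega>)) \<partial>M) \<le> ennreal (1 / cos (v * T / 2))"
  shows "prob {\<omega> \<in> space M. g (\<chi> i. S i \<omega>) - expectation (\<lambda>\<omega>. g (\<chi> i. S i \<omega>)) \<ge> x}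
    \<le> (1 + pi * x / (4 * real CARD('n) * c * T)) ^ (4 * CARD('n)) * exp (- (pi * x / (c * T)))"
proof -
  define n where "n = CARD('n)"
  have n: "0 < n" by (simp add: n_def)
  define y where "y = pi * x / (c * T)"
  have y: "0 < y" using assms by (simp add: y_def)
  \<comment> \<open>The minimizer of -u y - 4 n u - 4 n ln (1 - u): the derivative vanishes where 1
    - u = 4 n / (4 n + y).\<close>
  define u where "u = y / (4 * n + y)"
  have u: "0 < u" "u < 1" using y n by (auto simp: u_def)
  define l where "l = u * pi / (c * T)"
  have l: "0 < l" using u assms by (simp add: l_def)
  define D where "D i = distr M borel (S i)" for i
  have S [measurable]: "S i \<in> borel_measurable M" for i
    using indep by (auto simp: indep_vars_def)
  have D: "sech_tail (D i) T" for i
  proof -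
    interpret Di: prob_space "D i" unfolding D_def by (rule prob_space_distr) (rule S)
    show ?thesis
      by unfold_locales (use assms mgf in \<open>auto simp: D_def nn_integral_distr\<close>)
  qed
  define G where "G z = l * g (\<chi> i. z i)" for z
  have setsP: "sets (PiM UNIV D) = sets (PiM UNIV (\<lambda>_. borel))"
    by (intro sets_PiM_cong) (auto simp: D_def)
  have "continuous_on UNIV g"
  proof (rule lipschitz_on_continuous_on)
    \<comment> \<open>A crude comparison of the sum norm with n times the Euclidean norm: here only
      continuity of \<open>g\<close> is wanted, for measurability.\<close>
    show "(c * n)-lipschitz_on UNIV g"
    proof (rule lipschitz_onI)
      fix a b :: "real ^ 'n"
      have "(\<Sum>i\<in>UNIV. \<bar>a $ i - b $ i\<bar>) \<le> (\<Sum>i\<in>(UNIV::'n set). dist a b)"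
        using component_le_norm_cart[of "a - b"] by (intro sum_mono) (auto simp: dist_norm)
      also have "\<dots> = n * dist a b" by (simp add: n_def)
      finally show "dist (g a) (g b) \<le> c * n * dist a b"
        using lip[of a b] assms(1) unfolding dist_real_def
        by (smt (verit) mult.assoc mult_left_mono)
    qed (use assms in auto)
  qed
  then have [measurable]: "g \<in> borel_measurable borel" by (rule borel_measurable_continuous_onI)
  have "(\<lambda>z::'n \<Rightarrow> real. \<chi> i. z i) \<in> borel_measurable (PiM UNIV (\<lambda>_. borel))"
    by (subst borel_measurable_euclidean_space) (auto simp: Basis_vec_def inner_axis)
  then have [measurable]: "(\<lambda>z. g (\<chi> i. z i)) \<in> borel_measurable (PiM UNIV (\<lambda>_::'n. borel :: real measure))"
    by measurable
  then have G: "G \<in> borel_measurable (PiM UNIV (\<lambda>_. borel))"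
    unfolding G_def by measurable
  have GP: "G \<in> borel_measurable (PiM UNIV D)"
    using G by (simp add: measurable_cong_sets[OF setsP refl])
  have "\<bar>G a - G b\<bar> \<le> u * pi / T * (\<Sum>i\<in>UNIV. \<bar>a i - b i\<bar>)" for a b
  proof -
    have "\<bar>G a - G b\<bar> = l * \<bar>g (\<chi> i. a i) - g (\<chi> i. b i)\<bar>"
      using l by (simp add: G_def abs_mult flip: right_diff_distrib)
    also have "\<dots> \<le> l * (c * (\<Sum>i\<in>UNIV. \<bar>a i - b i\<bar>))"
      using lip[of "\<chi> i. a i" "\<chi> i. b i"] l by (intro mult_left_mono) auto
    also have "\<dots> = u * pi / T * (\<Sum>i\<in>UNIV. \<bar>a i - b i\<bar>)"
      using assms by (simp add: l_def)
    finally show ?thesis .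
  qed
  note conc = lipschitz_exp_tensorization[OF D less_imp_le[OF u(1)] u(2) finite_class.finite_UNIV GP this]
  have P: "PiM UNIV D = distr M (PiM UNIV (\<lambda>_. borel)) (\<lambda>\<omega>. \<lambda>i\<in>UNIV. S i \<omega>)"
    unfolding D_def using indep_vars_iff_distr_eq_PiM[of UNIV S "\<lambda>_. borel"] indep S by simp
  define Y where "Y \<omega> = g (\<chi> i. S i \<omega>) - expectation (\<lambda>\<omega>. g (\<chi> i. S i \<omega>))" for \<omega>
  have mS: "(\<lambda>\<omega>. \<lambda>i\<in>UNIV. S i \<omega>) \<in> measurable M (PiM UNIV (\<lambda>_. borel))" by measurable
  have EG: "(\<integral>z. G z \<partial>PiM UNIV D) = l * expectation (\<lambda>\<omega>. g (\<chi> i. S i \<omega>))"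
    unfolding P by (subst integral_distr[OF mS G]) (simp add: G_def)
  have "(\<integral>\<^sup>+\<omega>. ennreal (exp (l * Y \<omega>)) \<partial>M)
      = (\<integral>\<^sup>+z. ennreal (exp (G z - (\<integral>z. G z \<partial>PiM UNIV D))) \<partial>PiM UNIV D)"
    unfolding EG unfolding P using G
    by (subst nn_integral_distr[OF mS]) (auto simp: G_def Y_def right_diff_distrib)
  also have "\<dots> \<le> ennreal ((exp (- 4 * u) / (1 - u) ^ 4) ^ n)"
    using conc by (simp add: n_def)
  finally have mgfY: "(\<integral>\<^sup>+\<omega>. ennreal (exp (l * Y \<omega>)) \<partial>M) \<le> ennreal ((exp (- 4 * u) / (1 - u) ^ 4) ^ n)" .
  have "(\<lambda>\<omega>. (\<chi> i. S i \<omega>) :: real ^ 'n) \<in> borel_measurable M"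
    by (subst borel_measurable_euclidean_space) (auto simp: Basis_vec_def inner_axis)
  then have "Y \<in> borel_measurable M" unfolding Y_def by measurable
  then have "prob {\<omega> \<in> space M. x \<le> Y \<omega>} \<le> exp (- (l * x)) * (exp (- 4 * u) / (1 - u) ^ 4) ^ n"
    using mgfY l u by (intro chernoff_bound) auto
  also have "\<dots> = (1 / (1 - u)) ^ (4 * n) * exp (- (u * (y + 4 * n)))"
  proof -
    have "l * x = u * y" by (simp add: l_def y_def)
    then have "exp (- (l * x)) * exp (- 4 * u) ^ n = exp (- (u * (y + 4 * n)))"
      by (simp add: algebra_simps flip: exp_of_nat_mult exp_add)
    then show ?thesis by (simp add: power_divide power_mult)
  qed
  also have "u * (y + 4 * n) = y" using y n by (simp add: u_def add.commute)
  also have "1 / (1 - u) = 1 + y / (4 * n)" using y n by (simp add: u_def field_simps)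
  finally show ?thesis by (simp add: Y_def y_def n_def mult.assoc mult.commute mult.left_commute)
qed

section \<open>Increments of Brownian motion\<close>

text \<open>Converts the product formula for preimages, the form in which independence of increments
  is given, into \<open>indep_var\<close>. The preimages form intersection-stable families, so the
  formula extends to the generated sigma-algebras.\<close>

lemma (in prob_space) indep_varI:
  assumes Z: "random_variable S Z" and W: "random_variable T W"
    and indep: "\<And>a b. a \<in> sets S \<Longrightarrow> b \<in> sets T \<Longrightarrow>
      prob ((Z -` a \<inter> space M) \<inter> (W -` b \<inter> space M)) = prob (Z -` a \<inter> space M) * prob (W -` b \<inter> space M)"
  shows "indep_var S Z T W"
proof -
  have stable: "Int_stable {f -` A \<inter> space M | A. A \<in> sets K}" for f :: "'a \<Rightarrow> 'x" and K
  proof (safe intro!: Int_stableI)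
    fix A A' assume "A \<in> sets K" "A' \<in> sets K"
    then show "\<exists>C. (f -` A \<inter> space M) \<inter> (f -` A' \<inter> space M) = (f -` C \<inter> space M) \<and> C \<in> sets K"
      by (intro exI[of _ "A \<inter> A'"]) auto
  qed
  have "indep_set {Z -` A \<inter> space M | A. A \<in> sets S} {W -` A \<inter> space M | A. A \<in> sets T}"
    by (rule indep_setI) (use assms in \<open>auto intro: measurable_sets\<close>)
  then show ?thesis
    unfolding indep_var_eq using Z W by (intro conjI indep_set_sigma_sets stable) auto
qed

text \<open>The library constant \<open>indep_var\<close> forces both variables to take values in the same type,
  whence the explicit product formula in the hypothesis.\<close>

lemma (in prob_space) nn_integral_indep_pair:
  assumes Z [measurable]: "random_variable S Z" and W [measurable]: "random_variable T W"
    and indep: "\<And>a b. a \<in> sets S \<Longrightarrow> b \<in> sets T \<Longrightarrow>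
      prob ((Z -` a \<inter> space M) \<inter> (W -` b \<inter> space M)) = prob (Z -` a \<inter> space M) * prob (W -` b \<inter> space M)"
    and f [measurable]: "f \<in> borel_measurable (S \<Otimes>\<^sub>M T)"
  shows "(\<integral>\<^sup>+\<omega>. f (Z \<omega>, W \<omega>) \<partial>M) = (\<integral>\<^sup>+\<omega>. (\<integral>\<^sup>+\<omega>'. f (Z \<omega>, W \<omega>') \<partial>M) \<partial>M)"
proof -
  interpret Z: prob_space "distr M S Z" by (rule prob_space_distr) measurable
  interpret W: prob_space "distr M T W" by (rule prob_space_distr) measurable
  have "distr M S Z \<Otimes>\<^sub>M distr M T W = distr M (S \<Otimes>\<^sub>M T) (\<lambda>\<omega>. (Z \<omega>, W \<omega>))"
  proof (rule pair_measure_eqI)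
    fix a b assume "a \<in> sets (distr M S Z)" "b \<in> sets (distr M T W)"
    then have ab [measurable]: "a \<in> sets S" "b \<in> sets T" by auto
    have "emeasure (distr M (S \<Otimes>\<^sub>M T) (\<lambda>\<omega>. (Z \<omega>, W \<omega>))) (a \<times> b)
        = emeasure M ((Z -` a \<inter> space M) \<inter> (W -` b \<inter> space M))"
      by (subst emeasure_distr) (auto intro!: arg_cong[where f = "emeasure M"])
    then show "emeasure (distr M S Z) a * emeasure (distr M T W) b
        = emeasure (distr M (S \<Otimes>\<^sub>M T) (\<lambda>\<omega>. (Z \<omega>, W \<omega>))) (a \<times> b)"
      using indep[OF ab] by (simp add: emeasure_distr emeasure_eq_measure ennreal_mult)
  qed (auto intro: Z.sigma_finite_measure_axioms W.sigma_finite_measure_axioms)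
  note D = this
  have "(\<integral>\<^sup>+\<omega>. f (Z \<omega>, W \<omega>) \<partial>M) = (\<integral>\<^sup>+p. f p \<partial>distr M (S \<Otimes>\<^sub>M T) (\<lambda>\<omega>. (Z \<omega>, W \<omega>)))"
    by (subst nn_integral_distr) auto
  also have "\<dots> = (\<integral>\<^sup>+p. f p \<partial>(distr M S Z \<Otimes>\<^sub>M distr M T W))"
    by (simp add: D)
  also have "\<dots> = (\<integral>\<^sup>+z. (\<integral>\<^sup>+w. f (z, w) \<partial>distr M T W) \<partial>distr M S Z)"
    by (subst W.nn_integral_fst[symmetric]) auto
  also have "\<dots> = (\<integral>\<^sup>+\<omega>. (\<integral>\<^sup>+w. f (Z \<omega>, w) \<partial>distr M T W) \<partial>M)"
    by (subst nn_integral_distr) auto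
  also have "\<dots> = (\<integral>\<^sup>+\<omega>. (\<integral>\<^sup>+\<omega>'. f (Z \<omega>, W \<omega>') \<partial>M) \<partial>M)"
    by (intro nn_integral_cong nn_integral_distr) auto
  finally show ?thesis .
qed

text \<open>Completing the square: the weighted density is a constant multiple of the normal density
  with mean b h / (1 - a h) and variance h / (1 - a h).\<close>

lemma nn_integral_gaussian_exp_square:
  fixes a b h :: real
  assumes "0 < h" "a * h < 1"
  shows "(\<integral>\<^sup>+z. ennreal (normal_density 0 (sqrt h) z) * ennreal (exp (b * z + a * z\<^sup>2 / 2)) \<partial>lborel)
    = ennreal (exp (b\<^sup>2 * h / (2 * (1 - a * h))) / sqrt (1 - a * h))"
proof -
  define q where "q = 1 - a * h"
  have q: "0 < q" using assms by (simp add: q_def)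
  define C where "C = exp (b\<^sup>2 * h / (2 * q)) / sqrt q"
  have C: "0 < C" using q by (simp add: C_def)
  have a: "a = (1 - q) / h" using assms by (simp add: q_def)
  have *: "normal_density 0 (sqrt h) z * exp (b * z + a * z\<^sup>2 / 2)
      = C * normal_density (b * h / q) (sqrt (h / q)) z" for z
  proof -
    have e: "- (z\<^sup>2) / (2 * h) + (b * z + a * z\<^sup>2 / 2)
        = b\<^sup>2 * h / (2 * q) - (z - b * h / q)\<^sup>2 / (2 * (h / q))"
      unfolding a using q assms by (simp add: field_simps power2_eq_square)
    have "normal_density 0 (sqrt h) z * exp (b * z + a * z\<^sup>2 / 2)
        = 1 / sqrt (2 * pi * h) * exp (- (z\<^sup>2) / (2 * h) + (b * z + a * z\<^sup>2 / 2))"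
      using assms by (simp add: normal_density_def flip: exp_add)
    also have "\<dots> = 1 / sqrt (2 * pi * h) * (exp (b\<^sup>2 * h / (2 * q)) * exp (- ((z - b * h / q)\<^sup>2 / (2 * (h / q)))))"
      unfolding e by (simp add: exp_diff exp_minus field_simps)
    also have "\<dots> = C * normal_density (b * h / q) (sqrt (h / q)) z"
      using q assms by (simp add: normal_density_def C_def real_sqrt_divide real_sqrt_mult power_divide)
    finally show ?thesis .
  qed
  have "(\<integral>\<^sup>+z. ennreal (normal_density 0 (sqrt h) z) * ennreal (exp (b * z + a * z\<^sup>2 / 2)) \<partial>lborel)
      = (\<integral>\<^sup>+z. ennreal C * ennreal (normal_density (b * h / q) (sqrt (h / q)) z) \<partial>lborel)"
    using * C by (simp flip: ennreal_mult')
  also have "\<dots> = ennreal C * (\<integral>\<^sup>+z. ennreal (normal_density (b * h / q) (sqrt (h / q)) z) \<partial>lborel)"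
    by (rule nn_integral_cmult) measurable
  also have "(\<integral>\<^sup>+z. ennreal (normal_density (b * h / q) (sqrt (h / q)) z) \<partial>lborel) = 1"
    using q assms by (subst nn_integral_eq_integral) auto
  finally show ?thesis by (simp add: C_def q_def)
qed

lemma borel_measurable_vec_nth_comp [measurable (raw)]:
  fixes f :: "'a \<Rightarrow> real ^ 'n"
  assumes "f \<in> borel_measurable M"
  shows "(\<lambda>x. f x $ i) \<in> borel_measurable M"
  using assms by (simp add: cart_eq_inner_axis)

section \<open>The natural filtration and the increments of Brownian motion over it\<close>

lemma natural_filtration_space [simp]: "space (natural_filtration M B t) = space M"
  by (simp add: natural_filtration_def space_measure_of_conv)

lemma sets_natural_filtration:
  "sets (natural_filtration M B t)
    = sigma_sets (space M) (\<Union>s\<in>{0..t}. {B s -` A \<inter> space M | A. A \<in> sets borel})"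
  unfolding natural_filtration_def by (rule sets_measure_of) auto

lemma natural_filtration_mono:
  assumes "s \<le> t"
  shows "sets (natural_filtration M B s) \<subseteq> sets (natural_filtration M B t)"
  unfolding sets_natural_filtration using assms by (intro sigma_sets_mono') fastforce

lemma measurable_natural_filtration_mono:
  assumes "f \<in> measurable (natural_filtration M B s) N" "s \<le> t"
  shows "f \<in> measurable (natural_filtration M B t) N"
  using assms(1) natural_filtration_mono[OF assms(2), of M B] by (auto simp: measurable_def)

lemma measurable_natural_filtration_self:
  assumes "0 \<le> s" "s \<le> t"
  shows "B s \<in> borel_measurable (natural_filtration M B t)"
proof (rule measurableI)
  fix A :: "'b set" assume "A \<in> sets borel"
  then show "B s -` A \<inter> space (natural_filtration M B t) \<in> sets (natural_filtration M B t)"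
    unfolding sets_natural_filtration using assms by (intro sigma_sets.Basic UN_I[of s]) auto
qed simp

locale brownian = prob_space M for M :: "'a measure" +
  fixes B :: "real \<Rightarrow> 'a \<Rightarrow> real ^ 'd"
  assumes bm: "brownian_motion M B"
begin

abbreviation "\<F> \<equiv> natural_filtration M B"

lemma measurable_B [measurable]: "0 \<le> t \<Longrightarrow> B t \<in> borel_measurable M"
  using bm by (auto simp: brownian_motion_def)

lemma sets_F: "sets (\<F> t) \<subseteq> sets M"
  unfolding sets_natural_filtration by (rule sets.sigma_sets_subset) (auto intro: measurable_sets)

lemma measurable_F: "f \<in> measurable (\<F> t) N \<Longrightarrow> f \<in> measurable M N"
  using sets_F by (auto simp: measurable_def)

text \<open>\<open>Z\<close> may take values in any measurable space because the past will later be
  represented by a pair, the accumulated area and the present position.\<close>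

lemma prob_indep_increment:
  assumes "0 \<le> s" "s < t" "Z \<in> measurable (\<F> s) N" "a \<in> sets N" "b \<in> sets borel"
  shows "prob ((Z -` a \<inter> space M) \<inter> ((\<lambda>\<omega>. B t \<omega> - B s \<omega>) -` b \<inter> space M))
    = prob (Z -` a \<inter> space M) * prob ((\<lambda>\<omega>. B t \<omega> - B s \<omega>) -` b \<inter> space M)"
proof (rule indep_setD)
  show "indep_set (sets (\<F> s)) {(\<lambda>\<omega>. B t \<omega> - B s \<omega>) -` A \<inter> space M | A. A \<in> sets borel}"
    using bm assms by (auto simp: brownian_motion_def)
  show "Z -` a \<inter> space M \<in> sets (\<F> s)"
    using measurable_sets[OF assms(3,4)] by simp
qed (use assms in auto)

lemma indep_increment_nth:
  assumes "0 \<le> s" "s < t" "U \<in> borel_measurable (\<F> s)"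
  shows "indep_var borel U borel (\<lambda>\<omega>. B t \<omega> $ i - B s \<omega> $ i)"
proof (rule indep_varI)
  fix a b :: "real set"
  assume a: "a \<in> sets borel" and b: "b \<in> sets borel"
  have eq: "(\<lambda>\<omega>. B t \<omega> $ i - B s \<omega> $ i) -` b = (\<lambda>\<omega>. B t \<omega> - B s \<omega>) -` ((\<lambda>x. x $ i) -` b)"
    by auto
  have "(\<lambda>x::real ^ 'd. x $ i) -` b \<in> sets borel"
    using measurable_sets[of "\<lambda>x::real ^ 'd. x $ i" borel borel b] b by simp
  then show "prob ((U -` a \<inter> space M) \<inter> ((\<lambda>\<omega>. B t \<omega> $ i - B s \<omega> $ i) -` b \<inter> space M))
      = prob (U -` a \<inter> space M) * prob ((\<lambda>\<omega>. B t \<omega> $ i - B s \<omega> $ i) -` b \<inter> space M)"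
    unfolding eq using assms a by (intro prob_indep_increment) auto
qed (use assms measurable_F[OF assms(3)] in \<open>auto intro!: borel_measurable_diff\<close>)

lemma increment_normal:
  assumes "0 \<le> s" "s < t"
  shows "distributed M lborel (\<lambda>\<omega>. B t \<omega> $ i - B s \<omega> $ i) (normal_density 0 (sqrt (t - s)))"
  using bm assms by (auto simp: brownian_motion_def)

lemma increment_moments:
  assumes "0 \<le> s" "s \<le> t"
  shows "integrable M (\<lambda>\<omega>. B t \<omega> $ i - B s \<omega> $ i)"
    "expectation (\<lambda>\<omega>. B t \<omega> $ i - B s \<omega> $ i) = 0"
    "integrable M (\<lambda>\<omega>. (B t \<omega> $ i - B s \<omega> $ i)\<^sup>2)"
    "expectation (\<lambda>\<omega>. (B t \<omega> $ i - B s \<omega> $ i)\<^sup>2) = t - s"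
proof -
  have "integrable M (\<lambda>\<omega>. B t \<omega> $ i - B s \<omega> $ i) \<and>
    expectation (\<lambda>\<omega>. B t \<omega> $ i - B s \<omega> $ i) = 0 \<and>
    integrable M (\<lambda>\<omega>. (B t \<omega> $ i - B s \<omega> $ i)\<^sup>2) \<and>
    expectation (\<lambda>\<omega>. (B t \<omega> $ i - B s \<omega> $ i)\<^sup>2) = t - s"
  proof (cases "s = t")
    case False
    then have st: "s < t" using assms by simp
    note D = increment_normal[OF assms(1) st, of i]
    have sd: "0 < sqrt (t - s)" using st by simp
    have E: "expectation (\<lambda>\<omega>. B t \<omega> $ i - B s \<omega> $ i) = 0"
      by (rule normal_distributed_expectation[OF sd D])
    have V: "expectation (\<lambda>\<omega>. (B t \<omega> $ i - B s \<omega> $ i)\<^sup>2) = t - s"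
      using normal_distributed_variance[OF sd D] E st by simp
    have "integrable M (\<lambda>\<omega>. B t \<omega> $ i - B s \<omega> $ i)"
      using distributed_integrable[OF D, of "\<lambda>x. x"] integrable_normal_moment[OF sd, of 0 1] by simp
    moreover have "integrable M (\<lambda>\<omega>. (B t \<omega> $ i - B s \<omega> $ i)\<^sup>2)"
      using distributed_integrable[OF D, of "\<lambda>x. x\<^sup>2"] integrable_normal_moment[OF sd, of 0 2] by simp
    ultimately show ?thesis using E V by blast
  qed simp
  then show "integrable M (\<lambda>\<omega>. B t \<omega> $ i - B s \<omega> $ i)"
    "expectation (\<lambda>\<omega>. B t \<omega> $ i - B s \<omega> $ i) = 0"
    "integrable M (\<lambda>\<omega>. (B t \<omega> $ i - B s \<omega> $ i)\<^sup>2)"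
    "expectation (\<lambda>\<omega>. (B t \<omega> $ i - B s \<omega> $ i)\<^sup>2) = t - s"
    by blast+
qed

lemma expectation_mult_increment:
  assumes "0 \<le> s" "s \<le> t" "U \<in> borel_measurable (\<F> s)" "integrable M U"
  shows "expectation (\<lambda>\<omega>. U \<omega> * (B t \<omega> $ i - B s \<omega> $ i)) = 0"
proof (cases "s = t")
  case False
  then show ?thesis
    using indep_var_lebesgue_integral[OF indep_increment_nth[OF assms(1) _ assms(3), of t i]]
      assms increment_moments[OF assms(1,2), of i] by simp
qed simp

lemma expectation_mult_increment_square:
  assumes "0 \<le> s" "s \<le> t" "U \<in> borel_measurable (\<F> s)" "integrable M U"
  shows "integrable M (\<lambda>\<omega>. U \<omega> * (B t \<omega> $ i - B s \<omega> $ i)\<^sup>2)"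
    "expectation (\<lambda>\<omega>. U \<omega> * (B t \<omega> $ i - B s \<omega> $ i)\<^sup>2) = expectation U * (t - s)"
proof -
  have "integrable M (\<lambda>\<omega>. U \<omega> * (B t \<omega> $ i - B s \<omega> $ i)\<^sup>2) \<and>
    expectation (\<lambda>\<omega>. U \<omega> * (B t \<omega> $ i - B s \<omega> $ i)\<^sup>2) = expectation U * (t - s)"
  proof (cases "s = t")
    case False
    then have "indep_var borel U borel (\<lambda>\<omega>. (B t \<omega> $ i - B s \<omega> $ i)\<^sup>2)"
      using indep_var_compose[OF indep_increment_nth[OF assms(1) _ assms(3), of t i], of id borel "\<lambda>x. x\<^sup>2" borel]
        assms(2) by (simp add: comp_def id_def)
    then show ?thesis
      using indep_var_lebesgue_integral[OF _ assms(4) increment_moments(3)[OF assms(1,2), of i]]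
        indep_var_integrable[OF _ assms(4) increment_moments(3)[OF assms(1,2), of i]]
        increment_moments(4)[OF assms(1,2), of i] by simp
  qed simp
  then show "integrable M (\<lambda>\<omega>. U \<omega> * (B t \<omega> $ i - B s \<omega> $ i)\<^sup>2)"
    "expectation (\<lambda>\<omega>. U \<omega> * (B t \<omega> $ i - B s \<omega> $ i)\<^sup>2) = expectation U * (t - s)" by auto
qed

end

section \<open>The Ito isometry\<close>

lemma integrable_mult_square:
  fixes f g :: "'a \<Rightarrow> real"
  assumes "f \<in> borel_measurable M" "g \<in> borel_measurable M"
    and "integrable M (\<lambda>x. (f x)\<^sup>2)" "integrable M (\<lambda>x. (g x)\<^sup>2)"
  shows "integrable M (\<lambda>x. f x * g x)"
proof (rule Bochner_Integration.integrable_bound)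
  show "integrable M (\<lambda>x. (f x)\<^sup>2 + (g x)\<^sup>2)" using assms by simp
  show "AE x in M. norm (f x * g x) \<le> norm ((f x)\<^sup>2 + (g x)\<^sup>2)"
  proof (rule AE_I2)
    fix x
    have "2 * (\<bar>f x\<bar> * \<bar>g x\<bar>) \<le> (f x)\<^sup>2 + (g x)\<^sup>2"
      using zero_le_power2[of "\<bar>f x\<bar> - \<bar>g x\<bar>"] by (simp add: power2_diff)
    moreover have "0 \<le> \<bar>f x\<bar> * \<bar>g x\<bar>" by simp
    ultimately have "\<bar>f x\<bar> * \<bar>g x\<bar> \<le> (f x)\<^sup>2 + (g x)\<^sup>2" by linarith
    then show "norm (f x * g x) \<le> norm ((f x)\<^sup>2 + (g x)\<^sup>2)" by (simp add: abs_mult)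
  qed
qed (use assms in measurable)

text \<open>The length of the intersection of the intervals from a to b and from c to d.\<close>

definition overlap :: "real \<Rightarrow> real \<Rightarrow> real \<Rightarrow> real \<Rightarrow> real" where
  "overlap a b c d = max 0 (min b d - max a c)"

lemma overlap_commute: "overlap a b c d = overlap c d a b"
  by (simp add: overlap_def min.commute max.commute)

context brownian
begin

lemma measurable_increment [measurable]:
  assumes "0 \<le> a" "a \<le> b"
  shows "(\<lambda>\<omega>. B b \<omega> $ i - B a \<omega> $ i) \<in> borel_measurable M"
proof -
  have "0 \<le> b" using assms by simp
  with assms(1) show ?thesis by measurable
qed

lemma measurable_increment_F:
  assumes "0 \<le> a" "a \<le> b" "b \<le> c"
  shows "(\<lambda>\<omega>. B b \<omega> $ i - B a \<omega> $ i) \<in> borel_measurable (\<F> c)"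
proof -
  have [measurable]: "B b \<in> borel_measurable (\<F> c)" "B a \<in> borel_measurable (\<F> c)"
    using assms by (auto intro!: measurable_natural_filtration_self)
  show ?thesis by measurable
qed

lemma square_integrable_term:
  assumes "0 \<le> a" "a \<le> b" "\<xi> \<in> borel_measurable (\<F> a)" "integrable M (\<lambda>\<omega>. (\<xi> \<omega>)\<^sup>2)"
  shows "integrable M (\<lambda>\<omega>. (\<xi> \<omega> * (B b \<omega> $ i - B a \<omega> $ i))\<^sup>2)"
  using expectation_mult_increment_square(1)[OF assms(1,2), of "\<lambda>\<omega>. (\<xi> \<omega>)\<^sup>2" i] assms
  by (simp add: power_mult_distrib)

lemma measurable_term:
  assumes "0 \<le> a" "a \<le> b" "\<xi> \<in> borel_measurable (\<F> a)"
  shows "(\<lambda>\<omega>. \<xi> \<omega> * (B b \<omega> $ i - B a \<omega> $ i)) \<in> borel_measurable M"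
  using measurable_F[OF assms(3)] measurable_increment[OF assms(1,2)] by measurable

lemma integrable_term_mult:
  assumes "0 \<le> a" "a \<le> b" "\<xi> \<in> borel_measurable (\<F> a)" "integrable M (\<lambda>\<omega>. (\<xi> \<omega>)\<^sup>2)"
    and "0 \<le> c" "c \<le> d" "\<eta> \<in> borel_measurable (\<F> c)" "integrable M (\<lambda>\<omega>. (\<eta> \<omega>)\<^sup>2)"
  shows "integrable M (\<lambda>\<omega>. (\<xi> \<omega> * (B b \<omega> $ i - B a \<omega> $ i)) * (\<eta> \<omega> * (B d \<omega> $ i - B c \<omega> $ i)))"
  by (intro integrable_mult_square measurable_term square_integrable_term assms)

text \<open>All factors except the later increment are measurable at time c; that increment is
  independent of them and has mean 0.\<close>

lemma expectation_disjoint_terms: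
  assumes "0 \<le> a" "a \<le> b" "\<xi> \<in> borel_measurable (\<F> a)" "integrable M (\<lambda>\<omega>. (\<xi> \<omega>)\<^sup>2)"
    and "b \<le> c" "c \<le> d" "\<eta> \<in> borel_measurable (\<F> c)" "integrable M (\<lambda>\<omega>. (\<eta> \<omega>)\<^sup>2)"
  shows "expectation (\<lambda>\<omega>. (\<xi> \<omega> * (B b \<omega> $ i - B a \<omega> $ i)) * (\<eta> \<omega> * (B d \<omega> $ i - B c \<omega> $ i))) = 0"
proof -
  have ac: "a \<le> c" using assms by simp
  have "expectation (\<lambda>\<omega>. ((\<xi> \<omega> * (B b \<omega> $ i - B a \<omega> $ i)) * \<eta> \<omega>) * (B d \<omega> $ i - B c \<omega> $ i)) = 0"
  proof (rule expectation_mult_increment)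
    have [measurable]: "\<xi> \<in> borel_measurable (\<F> c)" "\<eta> \<in> borel_measurable (\<F> c)"
      "(\<lambda>\<omega>. B b \<omega> $ i - B a \<omega> $ i) \<in> borel_measurable (\<F> c)"
      using measurable_natural_filtration_mono[OF assms(3) ac] assms measurable_increment_F by auto
    show "(\<lambda>\<omega>. \<xi> \<omega> * (B b \<omega> $ i - B a \<omega> $ i) * \<eta> \<omega>) \<in> borel_measurable (\<F> c)" by measurable
    show "integrable M (\<lambda>\<omega>. \<xi> \<omega> * (B b \<omega> $ i - B a \<omega> $ i) * \<eta> \<omega>)"
      by (intro integrable_mult_square measurable_term square_integrable_term measurable_F[OF assms(7)] assms)
  qed (use assms in auto)
  then show ?thesis by (simp add: mult.assoc)
qed

lemma expectation_same_terms:
  assumes "0 \<le> a" "a \<le> b" "\<xi> \<in> borel_measurable (\<F> a)" "integrable M (\<lambda>\<omega>. (\<xi> \<omega>)\<^sup>2)"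
    and "\<eta> \<in> borel_measurable (\<F> a)" "integrable M (\<lambda>\<omega>. (\<eta> \<omega>)\<^sup>2)"
  shows "expectation (\<lambda>\<omega>. (\<xi> \<omega> * (B b \<omega> $ i - B a \<omega> $ i)) * (\<eta> \<omega> * (B b \<omega> $ i - B a \<omega> $ i)))
    = expectation (\<lambda>\<omega>. \<xi> \<omega> * \<eta> \<omega>) * (b - a)"
proof -
  have "integrable M (\<lambda>\<omega>. \<xi> \<omega> * \<eta> \<omega>)"
    by (intro integrable_mult_square measurable_F[OF assms(3)] measurable_F[OF assms(5)] assms)
  moreover have "(\<lambda>\<omega>. \<xi> \<omega> * \<eta> \<omega>) \<in> borel_measurable (\<F> a)"
    using assms by measurable
  ultimately show ?thesis
    using expectation_mult_increment_square(2)[OF assms(1,2), of "\<lambda>\<omega>. \<xi> \<omega> * \<eta> \<omega>" i]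
    by (simp add: power2_eq_square mult_ac)
qed

lemma expectation_terms:
  assumes "0 \<le> a" "a \<le> b" "\<xi> \<in> borel_measurable (\<F> a)" "integrable M (\<lambda>\<omega>. (\<xi> \<omega>)\<^sup>2)"
    and "0 \<le> c" "c \<le> d" "\<eta> \<in> borel_measurable (\<F> c)" "integrable M (\<lambda>\<omega>. (\<eta> \<omega>)\<^sup>2)"
  shows "expectation (\<lambda>\<omega>. (\<xi> \<omega> * (B b \<omega> $ i - B a \<omega> $ i)) * (\<eta> \<omega> * (B d \<omega> $ i - B c \<omega> $ i)))
    = expectation (\<lambda>\<omega>. \<xi> \<omega> * \<eta> \<omega>) * overlap a b c d"
proof -
  have ordered: "expectation (\<lambda>\<omega>. (\<xi> \<omega> * (B b \<omega> $ i - B a \<omega> $ i)) * (\<eta> \<omega> * (B d \<omega> $ i - B c \<omega> $ i)))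
    = expectation (\<lambda>\<omega>. \<xi> \<omega> * \<eta> \<omega>) * overlap a b c d"
    if "0 \<le> a" "a \<le> b" "\<xi> \<in> borel_measurable (\<F> a)" "integrable M (\<lambda>\<omega>. (\<xi> \<omega>)\<^sup>2)"
    and "c \<le> d" "\<eta> \<in> borel_measurable (\<F> c)" "integrable M (\<lambda>\<omega>. (\<eta> \<omega>)\<^sup>2)" "a \<le> c"
    for a b c d \<xi> \<eta>
  proof (cases "b \<le> c")
    case True
    then have "overlap a b c d = 0" by (simp add: overlap_def)
    then show ?thesis using expectation_disjoint_terms[OF that(1-4) True that(5-7)] by simp
  next
    case False
    \<comment> \<open>The first interval is cut at c and m, the second at m. Of the six products
      only the one with (c, m] in both factors survives: four pair disjoint intervals, and in the
      last one (m, b] or (m, d] is empty.\<close>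
    define m where "m = min b d"
    have m: "c \<le> m" "m \<le> b" "m \<le> d" "m = b \<or> m = d" using False that by (auto simp: m_def)
    have c0: "0 \<le> c" and m0: "0 \<le> m" using that m by auto
    have ov: "overlap a b c d = m - c" using that m False by (simp add: overlap_def m_def)
    note \<xi>c = measurable_natural_filtration_mono[OF that(3,8)]
    note \<xi>m = measurable_natural_filtration_mono[OF \<xi>c m(1)]
    note \<eta>m = measurable_natural_filtration_mono[OF that(6) m(1)]
    define P where "P p q r s \<omega> = (\<xi> \<omega> * (B q \<omega> $ i - B p \<omega> $ i)) * (\<eta> \<omega> * (B s \<omega> $ i - B r \<omega> $ i))" for p q r s \<omega>
    have I: "integrable M (P a c c m)" "integrable M (P a c m d)" "integrable M (P c m c m)"
      "integrable M (P c m m d)" "integrable M (P m b c m)" "integrable M (P m b m d)"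
      unfolding P_def
      using that m c0 m0 \<xi>c \<xi>m \<eta>m by (auto intro!: integrable_term_mult)
    have E1: "expectation (P a c c m) = 0" "expectation (P a c m d) = 0" "expectation (P c m m d) = 0"
      unfolding P_def using that m c0 m0 \<xi>c \<xi>m \<eta>m by (auto intro!: expectation_disjoint_terms)
    have E2: "expectation (P c m c m) = expectation (\<lambda>\<omega>. \<xi> \<omega> * \<eta> \<omega>) * (m - c)"
      unfolding P_def using that m c0 \<xi>c by (intro expectation_same_terms) auto
    \<comment> \<open>Here the interval of the second factor comes first, so the factors change
      places; \<open>\<xi>\<close> is measurable at time m as well.\<close>
    have "expectation (P m b c m)
        = expectation (\<lambda>\<omega>. (\<eta> \<omega> * (B m \<omega> $ i - B c \<omega> $ i)) * (\<xi> \<omega> * (B b \<omega> $ i - B m \<omega> $ i)))"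
      unfolding P_def by (intro Bochner_Integration.integral_cong refl) (simp add: mult_ac)
    also have "\<dots> = 0"
      using that m c0 \<xi>m by (intro expectation_disjoint_terms) auto
    finally have E3: "expectation (P m b c m) = 0" .
    have "P m b m d = (\<lambda>_. 0)" using m(4) by (auto simp: P_def fun_eq_iff)
    then have E4: "expectation (P m b m d) = 0" by simp
    have "P a b c d = (\<lambda>\<omega>. P a c c m \<omega> + P a c m d \<omega> + P c m c m \<omega> + P c m m d \<omega> + P m b c m \<omega> + P m b m d \<omega>)"
      by (simp add: P_def fun_eq_iff algebra_simps)
    then have "expectation (P a b c d) = expectation (\<lambda>\<omega>. \<xi> \<omega> * \<eta> \<omega>) * (m - c)"
      using I E1 E2 E3 E4 by simp
    then show ?thesis by (simp add: P_def[abs_def] ov)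
  qed
  show ?thesis
  proof (cases "a \<le> c")
    case True
    show ?thesis by (rule ordered[OF assms(1-4,6-8) True])
  next
    case False
    then have "c \<le> a" by simp
    from ordered[OF assms(5-8,2-4) this] show ?thesis
      by (simp add: overlap_commute[of a b] mult.commute)
  qed
qed

lemma expectation_square_sum:
  fixes A :: "'k set"
  assumes "finite A"
    and "\<And>k. k \<in> A \<Longrightarrow> 0 \<le> a k \<and> a k \<le> b k \<and> \<xi> k \<in> borel_measurable (\<F> (a k)) \<and> integrable M (\<lambda>\<omega>. (\<xi> k \<omega>)\<^sup>2)"
  shows "integrable M (\<lambda>\<omega>. (\<Sum>k\<in>A. \<xi> k \<omega> * (B (b k) \<omega> $ i - B (a k) \<omega> $ i))\<^sup>2)"
    and "integrable M (\<lambda>\<omega>. \<Sum>k\<in>A. \<Sum>l\<in>A. \<xi> k \<omega> * \<xi> l \<omega> * overlap (a k) (b k) (a l) (b l))"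
    and "expectation (\<lambda>\<omega>. (\<Sum>k\<in>A. \<xi> k \<omega> * (B (b k) \<omega> $ i - B (a k) \<omega> $ i))\<^sup>2)
      = expectation (\<lambda>\<omega>. \<Sum>k\<in>A. \<Sum>l\<in>A. \<xi> k \<omega> * \<xi> l \<omega> * overlap (a k) (b k) (a l) (b l))"
proof -
  have eq: "(\<Sum>k\<in>A. \<xi> k \<omega> * (B (b k) \<omega> $ i - B (a k) \<omega> $ i))\<^sup>2
    = (\<Sum>k\<in>A. \<Sum>l\<in>A. (\<xi> k \<omega> * (B (b k) \<omega> $ i - B (a k) \<omega> $ i)) * (\<xi> l \<omega> * (B (b l) \<omega> $ i - B (a l) \<omega> $ i)))" for \<omega>
    by (simp only: power2_eq_square sum_product)
  have I: "integrable M (\<lambda>\<omega>. (\<xi> k \<omega> * (B (b k) \<omega> $ i - B (a k) \<omega> $ i)) * (\<xi> l \<omega> * (B (b l) \<omega> $ i - B (a l) \<omega> $ i)))"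
    if "k \<in> A" "l \<in> A" for k l
    using assms(2)[OF that(1)] assms(2)[OF that(2)] by (intro integrable_term_mult) auto
  have I2: "integrable M (\<lambda>\<omega>. \<xi> k \<omega> * \<xi> l \<omega> * overlap (a k) (b k) (a l) (b l))"
    if "k \<in> A" "l \<in> A" for k l
    using assms(2)[OF that(1)] assms(2)[OF that(2)]
    by (intro integrable_mult_left integrable_mult_square) (auto intro: measurable_F)
  show "integrable M (\<lambda>\<omega>. (\<Sum>k\<in>A. \<xi> k \<omega> * (B (b k) \<omega> $ i - B (a k) \<omega> $ i))\<^sup>2)"
    unfolding eq using I by (intro Bochner_Integration.integrable_sum)
  show "integrable M (\<lambda>\<omega>. \<Sum>k\<in>A. \<Sum>l\<in>A. \<xi> k \<omega> * \<xi> l \<omega> * overlap (a k) (b k) (a l) (b l))"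
    using I2 by (intro Bochner_Integration.integrable_sum)
  have "expectation (\<lambda>\<omega>. (\<Sum>k\<in>A. \<xi> k \<omega> * (B (b k) \<omega> $ i - B (a k) \<omega> $ i))\<^sup>2)
      = (\<Sum>k\<in>A. \<Sum>l\<in>A. expectation (\<lambda>\<omega>. (\<xi> k \<omega> * (B (b k) \<omega> $ i - B (a k) \<omega> $ i)) * (\<xi> l \<omega> * (B (b l) \<omega> $ i - B (a l) \<omega> $ i))))"
    unfolding eq using I by (simp add: Bochner_Integration.integral_sum Bochner_Integration.integrable_sum)
  also have "\<dots> = (\<Sum>k\<in>A. \<Sum>l\<in>A. expectation (\<lambda>\<omega>. \<xi> k \<omega> * \<xi> l \<omega> * overlap (a k) (b k) (a l) (b l)))"
    using assms(2) by (intro sum.cong refl) (simp add: expectation_terms)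
  also have "\<dots> = expectation (\<lambda>\<omega>. \<Sum>k\<in>A. \<Sum>l\<in>A. \<xi> k \<omega> * \<xi> l \<omega> * overlap (a k) (b k) (a l) (b l))"
    using I2 by (simp add: Bochner_Integration.integral_sum Bochner_Integration.integrable_sum)
  finally show "expectation (\<lambda>\<omega>. (\<Sum>k\<in>A. \<xi> k \<omega> * (B (b k) \<omega> $ i - B (a k) \<omega> $ i))\<^sup>2)
      = expectation (\<lambda>\<omega>. \<Sum>k\<in>A. \<Sum>l\<in>A. \<xi> k \<omega> * \<xi> l \<omega> * overlap (a k) (b k) (a l) (b l))" .
qed

end

text \<open>The deterministic half of the isometry: a product of two indicators is the indicator of
  the intersection, so the time integral is the same quadratic form in \<open>overlap\<close> that
  the second moment of the stochastic sum produces. Its nonnegativity lets it pass between real and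
  extended nonnegative integrals.\<close>

lemma nn_integral_square_step:
  fixes A :: "'k set" and T :: real
  assumes "finite A" and "\<And>k. k \<in> A \<Longrightarrow> 0 \<le> a k \<and> a k \<le> b k \<and> b k \<le> T"
  shows "(\<integral>\<^sup>+t\<in>{0..T}. ennreal ((\<Sum>k\<in>A. x k * indicator {a k<..b k} t)\<^sup>2) \<partial>lborel)
      = ennreal (\<Sum>k\<in>A. \<Sum>l\<in>A. x k * x l * overlap (a k) (b k) (a l) (b l))"
    and "0 \<le> (\<Sum>k\<in>A. \<Sum>l\<in>A. x k * x l * overlap (a k) (b k) (a l) (b l))"
proof -
  have eq: "(\<Sum>k\<in>A. x k * indicator {a k<..b k} t)\<^sup>2
    = (\<Sum>k\<in>A. \<Sum>l\<in>A. x k * x l * indicator {max (a k) (a l)<..min (b k) (b l)} t)" for t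
    unfolding power2_eq_square sum_product
    by (intro sum.cong refl) (auto simp: indicator_def)
  have e: "emeasure lborel {p<..q} = ennreal (max 0 (q - p))" for p q :: real
    by (cases "p \<le> q") auto
  have m: "measure lborel {p<..q} = max 0 (q - p)" for p q :: real
    by (cases "p \<le> q") auto
  have I: "integrable lborel (indicator {max (a k) (a l)<..min (b k) (b l)} :: real \<Rightarrow> real)" for k l
    by (rule integrable_real_indicator) (auto simp only: e sets_lborel, auto)
  have L: "(\<integral>t. indicator {max (a k) (a l)<..min (b k) (b l)} t \<partial>lborel) = overlap (a k) (b k) (a l) (b l)" for k l
    by (simp add: overlap_def m)
  have int: "integrable lborel (\<lambda>t. (\<Sum>k\<in>A. x k * indicator {a k<..b k} t)\<^sup>2)"
    unfolding eq using I by (intro Bochner_Integration.integrable_sum integrable_mult_right)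
  have val: "(\<integral>t. (\<Sum>k\<in>A. x k * indicator {a k<..b k} t)\<^sup>2 \<partial>lborel)
      = (\<Sum>k\<in>A. \<Sum>l\<in>A. x k * x l * overlap (a k) (b k) (a l) (b l))"
    unfolding eq using I L by (simp add: Bochner_Integration.integral_sum Bochner_Integration.integrable_sum)
  have out: "(\<Sum>k\<in>A. x k * indicator {a k<..b k} t) = 0" if "t \<notin> {0..T}" for t
    using assms(2) that by (intro sum.neutral) (fastforce simp: indicator_def)
  have "(\<integral>\<^sup>+t\<in>{0..T}. ennreal ((\<Sum>k\<in>A. x k * indicator {a k<..b k} t)\<^sup>2) \<partial>lborel)
      = (\<integral>\<^sup>+t. ennreal ((\<Sum>k\<in>A. x k * indicator {a k<..b k} t)\<^sup>2) \<partial>lborel)"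
    using out by (intro nn_integral_cong) (auto simp: indicator_def)
  also have "\<dots> = ennreal (\<Sum>k\<in>A. \<Sum>l\<in>A. x k * x l * overlap (a k) (b k) (a l) (b l))"
    using int by (subst nn_integral_eq_integral) (auto simp: val)
  finally show "(\<integral>\<^sup>+t\<in>{0..T}. ennreal ((\<Sum>k\<in>A. x k * indicator {a k<..b k} t)\<^sup>2) \<partial>lborel)
      = ennreal (\<Sum>k\<in>A. \<Sum>l\<in>A. x k * x l * overlap (a k) (b k) (a l) (b l))" .
  show "0 \<le> (\<Sum>k\<in>A. \<Sum>l\<in>A. x k * x l * overlap (a k) (b k) (a l) (b l))"
    unfolding val[symmetric] by simp
qed

text \<open>The isometry is stated for sums over arbitrary, possibly overlapping intervals, so that it
  applies to a difference of two simple processes without passing to a common refinement.\<close>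

lemma (in brownian) ito_isometry:
  fixes A :: "'k set"
  assumes "finite A"
    and "\<And>k. k \<in> A \<Longrightarrow> 0 \<le> a k \<and> a k \<le> b k \<and> b k \<le> T \<and>
      \<xi> k \<in> borel_measurable (\<F> (a k)) \<and> integrable M (\<lambda>\<omega>. (\<xi> k \<omega>)\<^sup>2)"
  shows "(\<integral>\<^sup>+\<omega>. ennreal ((\<Sum>k\<in>A. \<xi> k \<omega> * (B (b k) \<omega> $ i - B (a k) \<omega> $ i))\<^sup>2) \<partial>M)
    = (\<integral>\<^sup>+\<omega>. (\<integral>\<^sup>+t\<in>{0..T}. ennreal ((\<Sum>k\<in>A. \<xi> k \<omega> * indicator {a k<..b k} t)\<^sup>2) \<partial>lborel) \<partial>M)"
proof -
  have A: "\<And>k. k \<in> A \<Longrightarrow> 0 \<le> a k \<and> a k \<le> b k \<and> b k \<le> T"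
    and A': "\<And>k. k \<in> A \<Longrightarrow> 0 \<le> a k \<and> a k \<le> b k \<and> \<xi> k \<in> borel_measurable (\<F> (a k)) \<and> integrable M (\<lambda>\<omega>. (\<xi> k \<omega>)\<^sup>2)"
    using assms(2) by blast+
  let ?Q = "\<lambda>\<omega>. \<Sum>k\<in>A. \<Sum>l\<in>A. \<xi> k \<omega> * \<xi> l \<omega> * overlap (a k) (b k) (a l) (b l)"
  have "(\<integral>\<^sup>+\<omega>. ennreal ((\<Sum>k\<in>A. \<xi> k \<omega> * (B (b k) \<omega> $ i - B (a k) \<omega> $ i))\<^sup>2) \<partial>M)
      = ennreal (expectation (\<lambda>\<omega>. (\<Sum>k\<in>A. \<xi> k \<omega> * (B (b k) \<omega> $ i - B (a k) \<omega> $ i))\<^sup>2))"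
    by (intro nn_integral_eq_integral expectation_square_sum(1)[OF assms(1)] A') auto
  also have "\<dots> = ennreal (expectation ?Q)"
    by (intro arg_cong[where f = ennreal] expectation_square_sum(3)[OF assms(1)] A')
  also have "\<dots> = (\<integral>\<^sup>+\<omega>. ennreal (?Q \<omega>) \<partial>M)"
    by (intro nn_integral_eq_integral[symmetric] expectation_square_sum(2)[OF assms(1)] A' AE_I2
        nn_integral_square_step(2)[where T = T, OF assms(1)] A)
  also have "\<dots> = (\<integral>\<^sup>+\<omega>. (\<integral>\<^sup>+t\<in>{0..T}. ennreal ((\<Sum>k\<in>A. \<xi> k \<omega> * indicator {a k<..b k} t)\<^sup>2) \<partial>lborel) \<partial>M)"
    by (intro nn_integral_cong nn_integral_square_step(1)[OF assms(1), symmetric] A)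
  finally show ?thesis .
qed

section \<open>Convergence of Riemann sums\<close>

text \<open>Takes the place of the triangle inequality in L2: it stays with squared norms, which may
  be infinite, at the price of a factor 2.\<close>

lemma ennreal_square_diff_le:
  fixes u v w :: real
  shows "ennreal ((u - w)\<^sup>2) \<le> 2 * ennreal ((u - v)\<^sup>2) + 2 * ennreal ((v - w)\<^sup>2)"
proof -
  have "(u - w)\<^sup>2 \<le> 2 * (u - v)\<^sup>2 + 2 * (v - w)\<^sup>2"
    using zero_le_power2[of "(u - v) - (v - w)"] by (simp add: power2_eq_square algebra_simps)
  then have "ennreal ((u - w)\<^sup>2) \<le> ennreal (2 * (u - v)\<^sup>2 + 2 * (v - w)\<^sup>2)"
    by (rule ennreal_leI)
  also have "\<dots> = 2 * ennreal ((u - v)\<^sup>2) + 2 * ennreal ((v - w)\<^sup>2)"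
    by (simp add: ennreal_plus ennreal_mult')
  finally show ?thesis .
qed

lemma simple_process_data_mono:
  assumes "simple_process_data M F T k \<tau> \<xi>" "p \<le> q" "q \<le> k"
  shows "\<tau> p \<le> \<tau> q"
  using assms(2,3)
proof (induction rule: dec_induct)
  case (step n)
  then have "\<tau> n < \<tau> (Suc n)" using assms(1) by (simp add: simple_process_data_def)
  with step show ?case by simp
qed simp

lemma simple_process_data_bounds:
  assumes "simple_process_data M F T k \<tau> \<xi>" "j < k"
  shows "0 \<le> \<tau> j" "\<tau> j \<le> \<tau> (Suc j)" "\<tau> (Suc j) \<le> T"
proof -
  have "\<tau> 0 = 0" "\<tau> k = T" using assms(1) by (auto simp: simple_process_data_def)
  then show "0 \<le> \<tau> j" "\<tau> j \<le> \<tau> (Suc j)" "\<tau> (Suc j) \<le> T"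
    using simple_process_data_mono[OF assms(1), of 0 j] simple_process_data_mono[OF assms(1), of j "Suc j"]
      simple_process_data_mono[OF assms(1), of "Suc j" k] assms(2) by auto
qed

context brownian
begin

lemma simple_ito_isometry:
  assumes d: "simple_process_data M \<F> T k \<tau> \<xi>" and d': "simple_process_data M \<F> T k' \<tau>' \<xi>'"
  shows "(\<integral>\<^sup>+\<omega>. ennreal ((simple_ito_integral k \<tau> \<xi> (\<lambda>t \<omega>. B t \<omega> $ i) \<omega>
        - simple_ito_integral k' \<tau>' \<xi>' (\<lambda>t \<omega>. B t \<omega> $ i) \<omega>)\<^sup>2) \<partial>M)
    = (\<integral>\<^sup>+\<omega>. (\<integral>\<^sup>+t\<in>{0..T}. ennreal ((simple_process k \<tau> \<xi> t \<omega> - simple_process k' \<tau>' \<xi>' t \<omega>)\<^sup>2) \<partial>lborel) \<partial>M)"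
proof -
  \<comment> \<open>The terms of both processes are collected over the disjoint union of their index
    sets, those of the second with a negative sign.\<close>
  define A where "A = {..<k} <+> {..<k'}"
  define a where "a = case_sum \<tau> \<tau>'"
  define b where "b = case_sum (\<lambda>j. \<tau> (Suc j)) (\<lambda>j. \<tau>' (Suc j))"
  define \<zeta> where "\<zeta> = case_sum \<xi> (\<lambda>j \<omega>. - \<xi>' j \<omega>)"
  have A: "finite A" by (simp add: A_def)
  have "0 \<le> a q \<and> a q \<le> b q \<and> b q \<le> T \<and> \<zeta> q \<in> borel_measurable (\<F> (a q)) \<and> integrable M (\<lambda>\<omega>. (\<zeta> q \<omega>)\<^sup>2)"
    if "q \<in> A" for q
    using that simple_process_data_bounds[OF d] simple_process_data_bounds[OF d'] d d'
    by (auto simp: A_def a_def b_def \<zeta>_def simple_process_data_def)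
  note terms = this
  have 1: "(\<Sum>q\<in>A. \<zeta> q \<omega> * (B (b q) \<omega> $ i - B (a q) \<omega> $ i))
    = simple_ito_integral k \<tau> \<xi> (\<lambda>t \<omega>. B t \<omega> $ i) \<omega> - simple_ito_integral k' \<tau>' \<xi>' (\<lambda>t \<omega>. B t \<omega> $ i) \<omega>" for \<omega>
    by (simp add: A_def sum.Plus a_def b_def \<zeta>_def simple_ito_integral_def sum_negf)
  have 2: "(\<Sum>q\<in>A. \<zeta> q \<omega> * indicator {a q<..b q} t)
    = simple_process k \<tau> \<xi> t \<omega> - simple_process k' \<tau>' \<xi>' t \<omega>" for t \<omega>
    unfolding A_def simple_process_def
    by (subst sum.Plus) (simp_all add: comp_def a_def b_def \<zeta>_def sum_negf)
  show ?thesis unfolding 1[symmetric] 2[symmetric] by (rule ito_isometry[OF A terms])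
qed

lemma measurable_simple_process:
  assumes "simple_process_data M \<F> T k \<tau> \<xi>"
  shows "(\<lambda>p. simple_process k \<tau> \<xi> (snd p) (fst p)) \<in> borel_measurable (M \<Otimes>\<^sub>M lborel)"
proof -
  have [measurable]: "\<xi> j \<in> borel_measurable M" if "j < k" for j
    using assms that by (auto simp: simple_process_data_def intro: measurable_F)
  show ?thesis unfolding simple_process_def
    by (intro borel_measurable_sum) auto
qed

lemma measurable_simple_ito:
  assumes "simple_process_data M \<F> T k \<tau> \<xi>"
  shows "simple_ito_integral k \<tau> \<xi> (\<lambda>t \<omega>. B t \<omega> $ i) \<in> borel_measurable M"
  unfolding simple_ito_integral_def
  using assms simple_process_data_bounds[OF assms]
  by (intro borel_measurable_sum measurable_term) (auto simp: simple_process_data_def)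

lemma B_zero: "AE \<omega> in M. B 0 \<omega> = 0"
  using bm by (simp add: brownian_motion_def)

lemma square_integrable_B:
  assumes "0 \<le> t"
  shows "integrable M (\<lambda>\<omega>. (B t \<omega> $ i)\<^sup>2)"
proof -
  have "AE \<omega> in M. (B t \<omega> $ i)\<^sup>2 = (B t \<omega> $ i - B 0 \<omega> $ i)\<^sup>2"
    using B_zero by eventually_elim simp
  then show ?thesis
    using increment_moments(3)[OF order_refl assms, of i] assms
    by (subst integrable_cong_AE) auto
qed

lemma simple_process_data_riemann:
  assumes "0 < T" "0 < N"
  shows "simple_process_data M \<F> T N (\<lambda>q. q * T / N) (\<lambda>q \<omega>. B (q * T / N) \<omega> $ j)"
proof -
  have "(\<lambda>\<omega>. B (real q * T / N) \<omega> $ j) \<in> borel_measurable (\<F> (q * T / N))" for q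
    using assms by (intro borel_measurable_vec_nth_comp measurable_natural_filtration_self) auto
  then show ?thesis
    using assms by (auto simp: simple_process_data_def divide_strict_right_mono intro!: square_integrable_B)
qed

lemma simple_process_riemann:
  fixes t T :: real
  assumes "0 < N" "0 < t" "t \<le> T"
  obtains q :: nat where "q < N" "q * T / N < t" "t \<le> q * T / N + T / N"
    "\<And>\<omega>. simple_process N (\<lambda>q. q * T / N) (\<lambda>q \<omega>. B (q * T / N) \<omega> $ j) t \<omega> = B (q * T / N) \<omega> $ j"
proof -
  have T: "0 < T" using assms by simp
  \<comment> \<open>The pieces are open on the left and closed on the right, so the index of the
    piece containing t is the ceiling minus 1 and not the floor.\<close>
  define c where "c = \<lceil>t * N / T\<rceil>"
  have c: "of_int c - 1 < t * N / T" "t * N / T \<le> of_int c"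
    unfolding c_def by linarith+
  have "0 < t * N / T" using assms T by simp
  then have c1: "1 \<le> c" unfolding c_def by linarith
  have "t * N / T \<le> N" using assms T by (simp add: field_simps)
  then have cN: "c \<le> int N" unfolding c_def by linarith
  define q where "q = nat (c - 1)"
  have rq: "real q = of_int c - 1" using c1 by (simp add: q_def)
  have qN: "q < N" using c1 cN by (simp add: q_def)
  have lo: "q * T / N < t" using c(1) assms T by (simp add: rq field_simps)
  have hi: "t \<le> Suc q * T / N" using c(2) assms T by (simp add: rq field_simps)
  have mono: "real p * T / N \<le> real p' * T / N" if "p \<le> p'" for p p'
    using that T assms by (intro divide_right_mono mult_right_mono) auto
  have ind: "indicator {real p * T / N<..real (Suc p) * T / N} t = (if p = q then 1 else 0 :: real)" for p
  proof -
    consider "p < q" | "p = q" | "q < p" by linarith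
    then show ?thesis
    proof cases
      case 1
      then have "real (Suc p) * T / N \<le> q * T / N" by (intro mono) simp
      then show ?thesis using 1 lo by (auto simp: indicator_def)
    next
      case 2
      then show ?thesis using lo hi by (auto simp: indicator_def)
    next
      case 3
      then have "real (Suc q) * T / N \<le> p * T / N" by (intro mono) simp
      then show ?thesis using 3 hi by (auto simp: indicator_def)
    qed
  qed
  have "simple_process N (\<lambda>q. q * T / N) (\<lambda>q \<omega>. B (q * T / N) \<omega> $ j) t \<omega> = B (q * T / N) \<omega> $ j" for \<omega>
    unfolding simple_process_def ind using qN by (simp add: if_distrib cong: if_cong)
  moreover have "t \<le> q * T / N + T / N" using hi by (simp add: distrib_right add_divide_distrib add.commute)
  ultimately show ?thesis using that[OF qN lo] by blast
qed

text \<open>For t > 0 the error is the variance of an increment over less than one piece or exactly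
  one. Time 0 lies in no piece, so the step process is 0 there, and \<open>B 0\<close> vanishes
  almost surely.\<close>

lemma riemann_process_error:
  fixes t T :: real
  assumes "0 < N" "0 \<le> t" "t \<le> T"
  shows "(\<integral>\<^sup>+\<omega>. ennreal ((B t \<omega> $ j
      - simple_process N (\<lambda>q. q * T / N) (\<lambda>q \<omega>. B (q * T / N) \<omega> $ j) t \<omega>)\<^sup>2) \<partial>M) \<le> ennreal (T / N)"
proof (cases "t = 0")
  case True
  have "simple_process N (\<lambda>q. q * T / N) (\<lambda>q \<omega>. B (q * T / N) \<omega> $ j) 0 \<omega> = 0" for \<omega>
  proof -
    have "indicator {real q * T / N<..real (Suc q) * T / N} 0 = (0 :: real)" for q
    proof -
      have "0 \<le> real q * T / N" using assms by simp
      then show ?thesis by (simp add: indicator_def)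
    qed
    then show ?thesis unfolding simple_process_def by (simp only: mult_zero_right sum.neutral_const)
  qed
  then have "(\<integral>\<^sup>+\<omega>. ennreal ((B t \<omega> $ j
      - simple_process N (\<lambda>q. q * T / N) (\<lambda>q \<omega>. B (q * T / N) \<omega> $ j) t \<omega>)\<^sup>2) \<partial>M)
      = (\<integral>\<^sup>+\<omega>. ennreal ((B 0 \<omega> $ j)\<^sup>2) \<partial>M)" using True by simp
  also have "\<dots> = (\<integral>\<^sup>+\<omega>. 0 \<partial>M)"
    using B_zero by (intro nn_integral_cong_AE) auto
  finally show ?thesis by simp
next
  case False
  then have "0 < t" using assms by simp
  then obtain q :: nat where q: "q < N" "q * T / N < t" "t \<le> q * T / N + T / N"
    "\<And>\<omega>. simple_process N (\<lambda>q. q * T / N) (\<lambda>q \<omega>. B (q * T / N) \<omega> $ j) t \<omega> = B (q * T / N) \<omega> $ j"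
    using simple_process_riemann[of N t T j] assms by blast
  have q0: "0 \<le> q * T / N" using assms by simp
  have "(\<integral>\<^sup>+\<omega>. ennreal ((B t \<omega> $ j - B (q * T / N) \<omega> $ j)\<^sup>2) \<partial>M) = ennreal (t - q * T / N)"
    using increment_moments(3,4)[OF q0 less_imp_le[OF q(2)], of j]
    by (subst nn_integral_eq_integral) auto
  also have "\<dots> \<le> ennreal (T / N)" using q by (intro ennreal_leI) simp
  finally show ?thesis by (simp add: q)
qed

text \<open>The definition supplies only some approximating simple processes, on unknown grids. By
  the isometry their integrals \<open>J m\<close> are as far from the Riemann sum \<open>R\<close>
  as the integrands are from each other; this distance is estimated through the true integrand. As m
  grows only the error \<open>D\<close> of the Riemann step process remains, and two uses of the
  squared triangle inequality give the factor 4.\<close>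

lemma ito_riemann_error:
  assumes T: "0 < T" and N: "0 < N"
    and ito: "has_ito_integral M \<F> (\<lambda>t \<omega>. B t \<omega> $ i) T (\<lambda>t \<omega>. B t \<omega> $ j) I"
  shows "(\<integral>\<^sup>+\<omega>. ennreal ((I \<omega> - simple_ito_integral N (\<lambda>q. q * T / N) (\<lambda>q \<omega>. B (q * T / N) \<omega> $ j)
      (\<lambda>t \<omega>. B t \<omega> $ i) \<omega>)\<^sup>2) \<partial>M) \<le> ennreal (4 * T\<^sup>2 / N)"
proof -
  have joint: "(\<lambda>(t, \<omega>). B t \<omega> $ j) \<in> borel_measurable (restrict_space borel {0..T} \<Otimes>\<^sub>M M)"
    and I [measurable]: "I \<in> borel_measurable M"
    using ito by (auto simp: has_ito_integral_def)
  obtain k \<tau> \<xi> where data: "\<And>m::nat. simple_process_data M \<F> T (k m) (\<tau> m) (\<xi> m)"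
    and approx: "(\<lambda>m. \<integral>\<^sup>+\<omega>. (\<integral>\<^sup>+t\<in>{0..T}. ennreal ((B t \<omega> $ j - simple_process (k m) (\<tau> m) (\<xi> m) t \<omega>)\<^sup>2) \<partial>lborel) \<partial>M)
          \<longlonglongrightarrow> 0"
    and lim: "(\<lambda>m. \<integral>\<^sup>+\<omega>. ennreal ((I \<omega> - simple_ito_integral (k m) (\<tau> m) (\<xi> m) (\<lambda>t \<omega>. B t \<omega> $ i) \<omega>)\<^sup>2) \<partial>M)
          \<longlonglongrightarrow> 0"
    using ito unfolding has_ito_integral_def by blast
  define X where "X m t \<omega> = simple_process (k m) (\<tau> m) (\<xi> m) t \<omega>" for m t \<omega>
  define J where "J m \<omega> = simple_ito_integral (k m) (\<tau> m) (\<xi> m) (\<lambda>t \<omega>. B t \<omega> $ i) \<omega>" for m \<omega>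
  define Y where "Y t \<omega> = simple_process N (\<lambda>q. q * T / N) (\<lambda>q \<omega>. B (q * T / N) \<omega> $ j) t \<omega>" for t \<omega>
  define R where "R \<omega> = simple_ito_integral N (\<lambda>q. q * T / N) (\<lambda>q \<omega>. B (q * T / N) \<omega> $ j) (\<lambda>t \<omega>. B t \<omega> $ i) \<omega>" for \<omega>
  note dataN = simple_process_data_riemann[OF T N, of j]
  have mJ [measurable]: "J m \<in> borel_measurable M" for m
    unfolding J_def[abs_def] by (rule measurable_simple_ito[OF data])
  have mR [measurable]: "R \<in> borel_measurable M"
    unfolding R_def[abs_def] by (rule measurable_simple_ito[OF dataN])
  have mX [measurable]: "(\<lambda>p. X m (snd p) (fst p)) \<in> borel_measurable (M \<Otimes>\<^sub>M lborel)" for m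
    unfolding X_def[abs_def] by (rule measurable_simple_process[OF data])
  have mY [measurable]: "(\<lambda>p. Y (snd p) (fst p)) \<in> borel_measurable (M \<Otimes>\<^sub>M lborel)"
    unfolding Y_def[abs_def] by (rule measurable_simple_process[OF dataN])
  text \<open>Clamping the time makes the integrand jointly measurable on the whole time axis.\<close>
  define H where "H t \<omega> = B (max 0 (min t T)) \<omega> $ j" for t \<omega>
  have mH [measurable]: "(\<lambda>p. H (snd p) (fst p)) \<in> borel_measurable (M \<Otimes>\<^sub>M lborel)"
  proof -
    have "(\<lambda>p. (max 0 (min (snd p) T), fst p)) \<in> measurable (M \<Otimes>\<^sub>M lborel) (restrict_space borel {0..T} \<Otimes>\<^sub>M M)"
      using T by (intro measurable_Pair measurable_restrict_space2) auto
    from measurable_compose[OF this joint] show ?thesis by (simp add: H_def)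
  qed
  have HB: "H t = (\<lambda>\<omega>. B t \<omega> $ j)" if "t \<in> {0..T}" for t
    using that by (auto simp: H_def fun_eq_iff)
  define E where "E m = (\<integral>\<^sup>+\<omega>. (\<integral>\<^sup>+t. ennreal ((H t \<omega> - X m t \<omega>)\<^sup>2) * indicator {0..T} t \<partial>lborel) \<partial>M)" for m
  define D where "D = (\<integral>\<^sup>+\<omega>. (\<integral>\<^sup>+t. ennreal ((H t \<omega> - Y t \<omega>)\<^sup>2) * indicator {0..T} t \<partial>lborel) \<partial>M)"
  define L where "L m = (\<integral>\<^sup>+\<omega>. ennreal ((I \<omega> - J m \<omega>)\<^sup>2) \<partial>M)" for m
  have "(\<integral>\<^sup>+\<omega>. (\<integral>\<^sup>+t\<in>{0..T}. ennreal ((B t \<omega> $ j - X m t \<omega>)\<^sup>2) \<partial>lborel) \<partial>M) = E m" for m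
    unfolding E_def using HB by (intro nn_integral_cong) (auto simp: indicator_def)
  then have E0: "E \<longlonglongrightarrow> 0" using approx by (simp add: X_def)
  have L0: "L \<longlonglongrightarrow> 0" using lim by (simp add: L_def[abs_def] J_def)

  have JR: "(\<integral>\<^sup>+\<omega>. ennreal ((J m \<omega> - R \<omega>)\<^sup>2) \<partial>M) \<le> 2 * E m + 2 * D" for m
  proof -
    have "(\<integral>\<^sup>+\<omega>. ennreal ((J m \<omega> - R \<omega>)\<^sup>2) \<partial>M)
        = (\<integral>\<^sup>+\<omega>. (\<integral>\<^sup>+t\<in>{0..T}. ennreal ((X m t \<omega> - Y t \<omega>)\<^sup>2) \<partial>lborel) \<partial>M)"
      unfolding J_def R_def X_def Y_def by (rule simple_ito_isometry[OF data dataN])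
    also have "\<dots> \<le> (\<integral>\<^sup>+\<omega>. (\<integral>\<^sup>+t. 2 * (ennreal ((H t \<omega> - X m t \<omega>)\<^sup>2) * indicator {0..T} t)
        + 2 * (ennreal ((H t \<omega> - Y t \<omega>)\<^sup>2) * indicator {0..T} t) \<partial>lborel) \<partial>M)"
    proof (intro nn_integral_mono)
      fix \<omega> t
      show "ennreal ((X m t \<omega> - Y t \<omega>)\<^sup>2) * indicator {0..T} t
          \<le> 2 * (ennreal ((H t \<omega> - X m t \<omega>)\<^sup>2) * indicator {0..T} t) + 2 * (ennreal ((H t \<omega> - Y t \<omega>)\<^sup>2) * indicator {0..T} t)"
        using ennreal_square_diff_le[of "X m t \<omega>" "Y t \<omega>" "H t \<omega>"]
        by (auto simp: indicator_def power2_commute[of "X m t \<omega>" "H t \<omega>"])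
    qed
    also have "\<dots> = 2 * E m + 2 * D"
    proof -
      have 1: "(\<lambda>t. ennreal ((H t \<omega> - X m t \<omega>)\<^sup>2) * indicator {0..T} t) \<in> borel_measurable lborel"
        and 2: "(\<lambda>t. ennreal ((H t \<omega> - Y t \<omega>)\<^sup>2) * indicator {0..T} t) \<in> borel_measurable lborel"
        if "\<omega> \<in> space M" for \<omega>
        using measurable_Pair2[OF _ that, of "\<lambda>p. ennreal ((H (snd p) (fst p) - X m (snd p) (fst p))\<^sup>2) * indicator {0..T} (snd p)" lborel borel]
          measurable_Pair2[OF _ that, of "\<lambda>p. ennreal ((H (snd p) (fst p) - Y (snd p) (fst p))\<^sup>2) * indicator {0..T} (snd p)" lborel borel]
        by auto
      have 3: "(\<lambda>\<omega>. \<integral>\<^sup>+t. ennreal ((H t \<omega> - X m t \<omega>)\<^sup>2) * indicator {0..T} t \<partial>lborel) \<in> borel_measurable M"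
        using lborel.borel_measurable_nn_integral_fst[of "\<lambda>p. ennreal ((H (snd p) (fst p) - X m (snd p) (fst p))\<^sup>2) * indicator {0..T} (snd p)" M]
        by simp
      have 4: "(\<lambda>\<omega>. \<integral>\<^sup>+t. ennreal ((H t \<omega> - Y t \<omega>)\<^sup>2) * indicator {0..T} t \<partial>lborel) \<in> borel_measurable M"
        using lborel.borel_measurable_nn_integral_fst[of "\<lambda>p. ennreal ((H (snd p) (fst p) - Y (snd p) (fst p))\<^sup>2) * indicator {0..T} (snd p)" M]
        by simp
      have "(\<integral>\<^sup>+t. 2 * (ennreal ((H t \<omega> - X m t \<omega>)\<^sup>2) * indicator {0..T} t)
          + 2 * (ennreal ((H t \<omega> - Y t \<omega>)\<^sup>2) * indicator {0..T} t) \<partial>lborel)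
        = 2 * (\<integral>\<^sup>+t. ennreal ((H t \<omega> - X m t \<omega>)\<^sup>2) * indicator {0..T} t \<partial>lborel)
          + 2 * (\<integral>\<^sup>+t. ennreal ((H t \<omega> - Y t \<omega>)\<^sup>2) * indicator {0..T} t \<partial>lborel)" if "\<omega> \<in> space M" for \<omega>
        using 1[OF that] 2[OF that] by (simp add: nn_integral_add nn_integral_cmult)
      then show ?thesis
        unfolding E_def D_def using 3 4
        by (simp add: nn_integral_add nn_integral_cmult cong: nn_integral_cong)
    qed
    finally show ?thesis .
  qed
  have IR: "(\<integral>\<^sup>+\<omega>. ennreal ((I \<omega> - R \<omega>)\<^sup>2) \<partial>M) \<le> 2 * L m + 2 * (2 * E m + 2 * D)" for m
  proof -
    have "(\<integral>\<^sup>+\<omega>. ennreal ((I \<omega> - R \<omega>)\<^sup>2) \<partial>M)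
        \<le> (\<integral>\<^sup>+\<omega>. 2 * ennreal ((I \<omega> - J m \<omega>)\<^sup>2) + 2 * ennreal ((J m \<omega> - R \<omega>)\<^sup>2) \<partial>M)"
      by (intro nn_integral_mono ennreal_square_diff_le)
    also have "\<dots> = 2 * L m + 2 * (\<integral>\<^sup>+\<omega>. ennreal ((J m \<omega> - R \<omega>)\<^sup>2) \<partial>M)"
      unfolding L_def by (simp add: nn_integral_add nn_integral_cmult)
    also have "\<dots> \<le> 2 * L m + 2 * (2 * E m + 2 * D)"
      by (intro add_left_mono mult_left_mono JR) auto
    finally show ?thesis .
  qed
  \<comment> \<open>Exchanging time and expectation makes the bound T / N at each fixed time
    applicable.\<close>
  have D: "D \<le> ennreal (T\<^sup>2 / N)"
  proof -
    interpret P: pair_sigma_finite M lborel ..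
    have "D = (\<integral>\<^sup>+t. (\<integral>\<^sup>+\<omega>. ennreal ((H t \<omega> - Y t \<omega>)\<^sup>2) * indicator {0..T} t \<partial>M) \<partial>lborel)"
      unfolding D_def
      using P.Fubini'[of "\<lambda>\<omega> t. ennreal ((H t \<omega> - Y t \<omega>)\<^sup>2) * indicator {0..T} t"]
      by (simp add: case_prod_beta')
    also have "\<dots> \<le> (\<integral>\<^sup>+t. ennreal (T / N) * indicator {0..T} t \<partial>lborel)"
    proof (rule nn_integral_mono)
      fix t
      show "(\<integral>\<^sup>+\<omega>. ennreal ((H t \<omega> - Y t \<omega>)\<^sup>2) * indicator {0..T} t \<partial>M) \<le> ennreal (T / N) * indicator {0..T} t"
        using riemann_process_error[OF N, of t T j] HB[of t] by (auto simp: indicator_def Y_def)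
    qed
    also have "\<dots> = ennreal (T\<^sup>2 / N)"
      using T N by (simp add: nn_integral_cmult_indicator power2_eq_square flip: ennreal_mult')
    finally show ?thesis .
  qed
  have "(\<lambda>m. 2 * L m + 2 * (2 * E m + 2 * D)) \<longlonglongrightarrow> 2 * 0 + 2 * (2 * 0 + 2 * D)"
    using E0 L0 by (intro tendsto_add tendsto_const ennreal_tendsto_cmult) auto
  then have "(\<integral>\<^sup>+\<omega>. ennreal ((I \<omega> - R \<omega>)\<^sup>2) \<partial>M) \<le> 2 * 0 + 2 * (2 * 0 + 2 * D)"
    using IR by (intro LIMSEQ_le_const) auto
  also have "\<dots> = 4 * D" by (simp add: mult.assoc[symmetric])
  also have "\<dots> \<le> 4 * ennreal (T\<^sup>2 / N)" using D by (intro mult_left_mono) auto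
  also have "\<dots> = ennreal (4 * (T\<^sup>2 / N))" by (subst ennreal_mult') auto
  finally show ?thesis by (simp add: R_def)
qed

end

section \<open>The exponential moment of the Levy area\<close>

locale planar_brownian = brownian M B for M :: "'a measure" and B :: "real \<Rightarrow> 'a \<Rightarrow> real ^ 2"
begin

text \<open>The product over two independent coordinates. The two factors 1 / sqrt (1 - a h)
  combine, and p and q enter only through p^2 + q^2; this rotational symmetry keeps the recursion
  below in one parameter.\<close>

lemma nn_integral_increment_gaussian:
  assumes "0 \<le> s" "s < t" "a * (t - s) < 1"
  shows "(\<integral>\<^sup>+\<omega>. ennreal (exp (p * (B t \<omega> - B s \<omega>) $ 1 + q * (B t \<omega> - B s \<omega>) $ 2
        + a * (((B t \<omega> - B s \<omega>) $ 1)\<^sup>2 + ((B t \<omega> - B s \<omega>) $ 2)\<^sup>2) / 2)) \<partial>M)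
    = ennreal (exp ((p\<^sup>2 + q\<^sup>2) * (t - s) / (2 * (1 - a * (t - s)))) / (1 - a * (t - s)))"
proof -
  define D where "D i \<omega> = (B t \<omega> - B s \<omega>) $ i" for i \<omega>
  define b where "b i = (if i = 1 then p else q)" for i :: 2
  have b: "b 1 = p" "b 2 = q" by (auto simp: b_def)
  define f where "f i z = ennreal (exp (b i * z + a * z\<^sup>2 / 2))" for i z
  have [measurable]: "f i \<in> borel_measurable borel" for i unfolding f_def by measurable
  have "indep_vars (\<lambda>_. borel) D UNIV"
    using bm assms by (auto simp: brownian_motion_def D_def[abs_def])
  then have ind: "indep_vars (\<lambda>_. borel) (\<lambda>i \<omega>. f i (D i \<omega>)) UNIV"
    by (rule indep_vars_compose2) measurable
  define h where "h = t - s"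
  have h: "0 < h" "a * h < 1" using assms by (auto simp: h_def)
  have one: "(\<integral>\<^sup>+\<omega>. f i (D i \<omega>) \<partial>M) = ennreal (exp ((b i)\<^sup>2 * h / (2 * (1 - a * h))) / sqrt (1 - a * h))" for i
  proof -
    have "distributed M lborel (D i) (normal_density 0 (sqrt h))"
      using bm assms by (auto simp: brownian_motion_def D_def[abs_def] h_def)
    then have "(\<integral>\<^sup>+\<omega>. f i (D i \<omega>) \<partial>M) = (\<integral>\<^sup>+z. ennreal (normal_density 0 (sqrt h) z) * f i z \<partial>lborel)"
      by (intro distributed_nn_integral[symmetric]) auto
    then show ?thesis unfolding f_def using nn_integral_gaussian_exp_square[OF h] by simp
  qed
  have "(\<integral>\<^sup>+\<omega>. ennreal (exp (p * D 1 \<omega> + q * D 2 \<omega> + a * ((D 1 \<omega>)\<^sup>2 + (D 2 \<omega>)\<^sup>2) / 2)) \<partial>M)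
      = (\<integral>\<^sup>+\<omega>. (\<Prod>i\<in>UNIV. f i (D i \<omega>)) \<partial>M)"
    by (intro nn_integral_cong)
       (simp add: UNIV_2 f_def b algebra_simps add_divide_distrib flip: ennreal_mult' exp_add)
  also have "\<dots> = (\<Prod>i\<in>UNIV. \<integral>\<^sup>+\<omega>. f i (D i \<omega>) \<partial>M)"
    by (rule indep_vars_nn_integral[OF _ ind]) auto
  also have "\<dots> = ennreal (exp (p\<^sup>2 * h / (2 * (1 - a * h))) / sqrt (1 - a * h)
      * (exp (q\<^sup>2 * h / (2 * (1 - a * h))) / sqrt (1 - a * h)))"
    using h by (simp add: UNIV_2 one b flip: ennreal_mult')
  also have "exp (p\<^sup>2 * h / (2 * (1 - a * h))) / sqrt (1 - a * h)
      * (exp (q\<^sup>2 * h / (2 * (1 - a * h))) / sqrt (1 - a * h))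
      = exp ((p\<^sup>2 + q\<^sup>2) * h / (2 * (1 - a * h))) / (1 - a * h)"
    using h by (simp add: distrib_right add_divide_distrib flip: exp_add)
  finally show ?thesis by (simp add: D_def h_def)
qed

text \<open>Each summand equals the cross product of consecutive positions, so this is the signed
  area swept from the origin by the polygon through the points B (q h). Step length and number of
  steps are separate parameters so that an induction can peel off the last step.\<close>

definition discrete_area :: "real \<Rightarrow> nat \<Rightarrow> 'a \<Rightarrow> real" where
  "discrete_area h k \<omega> = (\<Sum>q<k. B (real q * h) \<omega> $ 1 * (B (real (Suc q) * h) \<omega> $ 2 - B (real q * h) \<omega> $ 2)
     - B (real q * h) \<omega> $ 2 * (B (real (Suc q) * h) \<omega> $ 1 - B (real q * h) \<omega> $ 1)) / 2"

lemma measurable_discrete_area: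
  assumes "0 < h"
  shows "discrete_area h k \<in> borel_measurable (\<F> (real k * h))"
proof -
  have [measurable]: "B (real q * h) \<in> borel_measurable (\<F> (real k * h))" if "q \<le> k" for q
    using that assms by (intro measurable_natural_filtration_self) auto
  have "(\<lambda>\<omega>. B (real q * h) \<omega> $ i) \<in> borel_measurable (\<F> (real k * h))" if "q \<le> k" for q i
    using that by measurable
  then show ?thesis unfolding discrete_area_def
    by (intro borel_measurable_divide borel_measurable_sum borel_measurable_diff borel_measurable_times)
       (auto simp del: of_nat_Suc)
qed

text \<open>Backward induction: integrating out the last increment turns the parameter
  \<open>a = \<mu> tan (j \<delta>)\<close> of the Gaussian factor into \<open>(a + h \<mu>\<^sup>2) / (1 - h a)\<close>, which is
  \<open>\<mu> tan ((j + 1) \<delta>)\<close> by the addition theorem for the tangent as \<open>h \<mu> = tan \<delta>\<close>.\<close>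

lemma discrete_area_exp_moment:
  assumes h: "0 < h" and \<mu>: "\<delta> = arctan (h * \<mu>)" and small: "\<bar>real (j + k) * \<delta>\<bar> < pi / 2"
  shows "(\<integral>\<^sup>+\<omega>. ennreal (exp (2 * \<mu> * discrete_area h k \<omega>
      + \<mu> * tan (j * \<delta>) * ((B (real k * h) \<omega> $ 1)\<^sup>2 + (B (real k * h) \<omega> $ 2)\<^sup>2) / 2)) \<partial>M)
    = ennreal (cos \<delta> ^ k * cos (j * \<delta>) / cos (real (j + k) * \<delta>))"
  using small
proof (induction k arbitrary: j)
  case 0
  have "cos (real j * \<delta>) > 0" using 0 by (intro cos_gt_zero_pi) auto
  moreover have "(\<integral>\<^sup>+\<omega>. ennreal (exp (2 * \<mu> * discrete_area h 0 \<omega>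
      + \<mu> * tan (j * \<delta>) * ((B (real 0 * h) \<omega> $ 1)\<^sup>2 + (B (real 0 * h) \<omega> $ 2)\<^sup>2) / 2)) \<partial>M) = (\<integral>\<^sup>+\<omega>. 1 \<partial>M)"
    using B_zero by (intro nn_integral_cong_AE) (auto simp: discrete_area_def)
  ultimately show ?case by (simp add: emeasure_space_1)
next
  case (Suc k)
  have le: "\<bar>real m * \<delta>\<bar> < pi / 2" if "m \<le> j + Suc k" for m
  proof -
    have "\<bar>real m * \<delta>\<bar> \<le> \<bar>real (j + Suc k) * \<delta>\<bar>"
      using that unfolding abs_mult by (intro mult_right_mono) auto
    then show ?thesis using Suc.prems by linarith
  qed
  have pos: "0 < cos (real m * \<delta>)" if "m \<le> j + Suc k" for m
    using le[OF that] by (intro cos_gt_zero_pi) auto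
  define s where "s = real k * h"
  define t where "t = real (Suc k) * h"
  have st: "0 \<le> s" "s < t" "t - s = h" using h by (auto simp: s_def t_def algebra_simps)
  define \<theta> where "\<theta> = real j * \<delta>"
  have \<theta>: "0 < cos \<theta>" "0 < cos \<delta>" "0 < cos (\<theta> + \<delta>)"
    using pos[of j] pos[of 1] pos[of "Suc j"] by (auto simp: \<theta>_def algebra_simps)
  have tan\<delta>: "h * \<mu> = tan \<delta>" by (simp add: \<mu> arctan)
  define a where "a = \<mu> * tan \<theta>"
  \<comment> \<open>This is positive because the angle (j + 1) \<delta> still lies in (-pi / 2, pi /
    2), and positivity is the condition for the Gaussian integral of the increment to be
    finite.\<close>
  have ah: "1 - a * h = cos (\<theta> + \<delta>) / (cos \<theta> * cos \<delta>)"
  proof -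
    have "1 - a * h = 1 - tan \<theta> * tan \<delta>" unfolding a_def tan\<delta>[symmetric] by simp
    then show ?thesis using \<theta> by (simp add: tan_def cos_add field_simps)
  qed
  have ah1: "a * h < 1" using ah \<theta> by (metis diff_gt_0_iff_gt divide_pos_pos mult_pos_pos)
  define a' where "a' = \<mu> * tan (\<theta> + \<delta>)"
  have a': "a + (a\<^sup>2 + \<mu>\<^sup>2) * h / (1 - a * h) = a'"
  proof -
    have "a + (a\<^sup>2 + \<mu>\<^sup>2) * h / (1 - a * h) = (a + \<mu> * (h * \<mu>)) / (1 - a * h)"
      using ah1 by (simp add: field_simps power2_eq_square)
    also have "\<dots> = \<mu> * ((tan \<theta> + tan \<delta>) / (1 - tan \<theta> * tan \<delta>))"
      unfolding tan\<delta>[symmetric] a_def by (simp add: algebra_simps)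
    also have "\<dots> = a'" using \<theta> by (simp add: a'_def tan_add)
    finally show ?thesis .
  qed
  \<comment> \<open>The past up to time s enters only through the accumulated area and the position,
    the last step only through the increment \<open>W\<close>.\<close>
  define Z where "Z \<omega> = (discrete_area h k \<omega>, B s \<omega>)" for \<omega>
  define W where "W \<omega> = B t \<omega> - B s \<omega>" for \<omega>
  define \<phi> where "\<phi> z w = ennreal (exp (2 * \<mu> * (fst z + (snd z $ 1 * w $ 2 - snd z $ 2 * w $ 1) / 2)
      + a * ((snd z $ 1 + w $ 1)\<^sup>2 + (snd z $ 2 + w $ 2)\<^sup>2) / 2))"
    for z :: "real \<times> (real ^ 2)" and w :: "real ^ 2"
  have mZ: "Z \<in> measurable (\<F> s) (borel \<Otimes>\<^sub>M borel)"
    unfolding Z_def using measurable_discrete_area[OF h, of k] st(1)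
    by (intro measurable_Pair measurable_natural_filtration_self) (auto simp: s_def)
  have [measurable]: "B s \<in> borel_measurable M" "B t \<in> borel_measurable M"
    using st by (auto intro: measurable_B)
  have mW [measurable]: "W \<in> borel_measurable M"
    unfolding W_def by measurable
  have \<phi>: "(\<lambda>(z, w). \<phi> z w) \<in> borel_measurable ((borel \<Otimes>\<^sub>M borel) \<Otimes>\<^sub>M borel)"
    unfolding \<phi>_def by measurable
  have step: "discrete_area h (Suc k) \<omega>
      = discrete_area h k \<omega> + (B s \<omega> $ 1 * W \<omega> $ 2 - B s \<omega> $ 2 * W \<omega> $ 1) / 2" for \<omega>
    by (simp add: discrete_area_def s_def t_def W_def add_divide_distrib)
  have "(\<integral>\<^sup>+\<omega>. ennreal (exp (2 * \<mu> * discrete_area h (Suc k) \<omega> + a * ((B t \<omega> $ 1)\<^sup>2 + (B t \<omega> $ 2)\<^sup>2) / 2)) \<partial>M)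
      = (\<integral>\<^sup>+\<omega>. (case (Z \<omega>, W \<omega>) of (z, w) \<Rightarrow> \<phi> z w) \<partial>M)"
    unfolding step by (simp add: Z_def W_def \<phi>_def)
  also have "\<dots> = (\<integral>\<^sup>+\<omega>. (\<integral>\<^sup>+\<omega>'. (case (Z \<omega>, W \<omega>') of (z, w) \<Rightarrow> \<phi> z w) \<partial>M) \<partial>M)"
    unfolding W_def
    by (rule nn_integral_indep_pair[OF measurable_F[OF mZ] mW[unfolded W_def] prob_indep_increment[OF st(1,2) mZ] \<phi>])
  also have "\<dots> = (\<integral>\<^sup>+\<omega>. ennreal (1 / (1 - a * h)) * ennreal (exp (2 * \<mu> * discrete_area h k \<omega>
      + a' * ((B s \<omega> $ 1)\<^sup>2 + (B s \<omega> $ 2)\<^sup>2) / 2)) \<partial>M)"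
  proof (intro nn_integral_cong)
    fix \<omega>
    define A where "A = discrete_area h k \<omega>"
    define x where "x = B s \<omega> $ 1"
    define y where "y = B s \<omega> $ 2"
    have "(\<integral>\<^sup>+\<omega>'. (case (Z \<omega>, W \<omega>') of (z, w) \<Rightarrow> \<phi> z w) \<partial>M)
        = (\<integral>\<^sup>+\<omega>'. ennreal (exp (2 * \<mu> * A + a * (x\<^sup>2 + y\<^sup>2) / 2))
          * ennreal (exp ((a * x - \<mu> * y) * W \<omega>' $ 1 + (a * y + \<mu> * x) * W \<omega>' $ 2
            + a * ((W \<omega>' $ 1)\<^sup>2 + (W \<omega>' $ 2)\<^sup>2) / 2)) \<partial>M)"
      by (intro nn_integral_cong)
         (simp add: Z_def \<phi>_def A_def x_def y_def power2_eq_square field_simps flip: ennreal_mult' exp_add)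
    also have "\<dots> = ennreal (exp (2 * \<mu> * A + a * (x\<^sup>2 + y\<^sup>2) / 2))
        * (\<integral>\<^sup>+\<omega>'. ennreal (exp ((a * x - \<mu> * y) * W \<omega>' $ 1 + (a * y + \<mu> * x) * W \<omega>' $ 2
            + a * ((W \<omega>' $ 1)\<^sup>2 + (W \<omega>' $ 2)\<^sup>2) / 2)) \<partial>M)"
      by (rule nn_integral_cmult) measurable
    also have "(\<integral>\<^sup>+\<omega>'. ennreal (exp ((a * x - \<mu> * y) * W \<omega>' $ 1 + (a * y + \<mu> * x) * W \<omega>' $ 2
            + a * ((W \<omega>' $ 1)\<^sup>2 + (W \<omega>' $ 2)\<^sup>2) / 2)) \<partial>M)
        = ennreal (exp (((a * x - \<mu> * y)\<^sup>2 + (a * y + \<mu> * x)\<^sup>2) * h / (2 * (1 - a * h))) / (1 - a * h))"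
      unfolding W_def using nn_integral_increment_gaussian[OF st(1,2)] ah1 by (simp add: st(3))
    also have "ennreal (exp (2 * \<mu> * A + a * (x\<^sup>2 + y\<^sup>2) / 2)) * \<dots>
        = ennreal (1 / (1 - a * h)) * ennreal (exp (2 * \<mu> * A + a' * (x\<^sup>2 + y\<^sup>2) / 2))"
    proof -
      \<comment> \<open>The linear coefficients form the vector a (x, y) + \<mu> (-y, x), a sum of
        orthogonal vectors. Its squared length is a multiple of x^2 + y^2, which is why the Gaussian
        factor keeps its form.\<close>
      have "(a * x - \<mu> * y)\<^sup>2 + (a * y + \<mu> * x)\<^sup>2 = (a\<^sup>2 + \<mu>\<^sup>2) * (x\<^sup>2 + y\<^sup>2)"
        by (simp add: power2_eq_square algebra_simps)
      then have "a * (x\<^sup>2 + y\<^sup>2) / 2 + ((a * x - \<mu> * y)\<^sup>2 + (a * y + \<mu> * x)\<^sup>2) * h / (2 * (1 - a * h))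
          = (a + (a\<^sup>2 + \<mu>\<^sup>2) * h / (1 - a * h)) * (x\<^sup>2 + y\<^sup>2) / 2"
        using ah1 by (simp add: field_simps)
      then have "exp (2 * \<mu> * A + a * (x\<^sup>2 + y\<^sup>2) / 2)
          * (exp (((a * x - \<mu> * y)\<^sup>2 + (a * y + \<mu> * x)\<^sup>2) * h / (2 * (1 - a * h))) / (1 - a * h))
          = 1 / (1 - a * h) * exp (2 * \<mu> * A + a' * (x\<^sup>2 + y\<^sup>2) / 2)"
        unfolding a' by (simp add: add.assoc flip: exp_add)
      then show ?thesis using ah1 by (simp flip: ennreal_mult')
    qed
    finally show "(\<integral>\<^sup>+\<omega>'. (case (Z \<omega>, W \<omega>') of (z, w) \<Rightarrow> \<phi> z w) \<partial>M)
        = ennreal (1 / (1 - a * h)) * ennreal (exp (2 * \<mu> * discrete_area h k \<omega>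
          + a' * ((B s \<omega> $ 1)\<^sup>2 + (B s \<omega> $ 2)\<^sup>2) / 2))"
      by (simp add: A_def x_def y_def)
  qed
  also have "\<dots> = ennreal (1 / (1 - a * h)) * (\<integral>\<^sup>+\<omega>. ennreal (exp (2 * \<mu> * discrete_area h k \<omega>
      + a' * ((B s \<omega> $ 1)\<^sup>2 + (B s \<omega> $ 2)\<^sup>2) / 2)) \<partial>M)"
  proof (rule nn_integral_cmult)
    have [measurable]: "discrete_area h k \<in> borel_measurable M" "B s \<in> borel_measurable M"
      using measurable_F[OF measurable_discrete_area[OF h]] st by auto
    show "(\<lambda>\<omega>. ennreal (exp (2 * \<mu> * discrete_area h k \<omega>
      + a' * ((B s \<omega> $ 1)\<^sup>2 + (B s \<omega> $ 2)\<^sup>2) / 2))) \<in> borel_measurable M" by measurable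
  qed
  also have "(\<integral>\<^sup>+\<omega>. ennreal (exp (2 * \<mu> * discrete_area h k \<omega>
      + a' * ((B s \<omega> $ 1)\<^sup>2 + (B s \<omega> $ 2)\<^sup>2) / 2)) \<partial>M)
      = ennreal (cos \<delta> ^ k * cos (real (Suc j) * \<delta>) / cos (real (Suc j + k) * \<delta>))"
    using Suc.IH[of "Suc j"] Suc.prems by (simp add: a'_def \<theta>_def s_def algebra_simps)
  also have "ennreal (1 / (1 - a * h)) * \<dots>
      = ennreal (1 / (1 - a * h) * (cos \<delta> ^ k * cos (real (Suc j) * \<delta>) / cos (real (Suc j + k) * \<delta>)))"
    using ah1 by (intro ennreal_mult'[symmetric]) auto
  \<comment> \<open>The factor cos (\<theta> + \<delta>) of 1 - a h cancels against cos ((j + 1)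
    \<delta>) from the induction hypothesis and leaves cos \<theta> and one more cos
    \<delta>.\<close>
  also have "1 / (1 - a * h) * (cos \<delta> ^ k * cos (real (Suc j) * \<delta>) / cos (real (Suc j + k) * \<delta>))
      = cos \<delta> ^ Suc k * cos (real j * \<delta>) / cos (real (j + Suc k) * \<delta>)"
  proof -
    have "cos (real (Suc j) * \<delta>) = cos (\<theta> + \<delta>)" by (simp add: \<theta>_def algebra_simps)
    then show ?thesis using \<theta> unfolding ah by (simp add: \<theta>_def)
  qed
  finally show ?case by (simp add: a_def \<theta>_def t_def)
qed

end

section \<open>From Riemann sums to the Levy area\<close>

context planar_brownian
begin

text \<open>The case j = 0, \<mu> = v / 2 of the exact formula is cos \<delta> ^ N / cos (N
  \<delta>). Since |arctan z| <= |z|, the angle N |\<delta>| is at most |v| T / 2; the resulting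
  bound does not depend on N.\<close>

lemma discrete_area_exp_le:
  assumes "0 < T" "0 < N" "\<bar>v\<bar> < pi / T"
  shows "(\<integral>\<^sup>+\<omega>. ennreal (exp (v * discrete_area (T / real N) N \<omega>)) \<partial>M) \<le> ennreal (1 / cos (v * T / 2))"
proof -
  define h where "h = T / real N"
  have h: "0 < h" using assms by (simp add: h_def)
  define \<delta> where "\<delta> = arctan (h * (v / 2))"
  have vT: "\<bar>v * T / 2\<bar> < pi / 2" using assms by (simp add: abs_mult field_simps)
  have "\<bar>real N * \<delta>\<bar> \<le> real N * \<bar>h * (v / 2)\<bar>"
    unfolding abs_mult[of "real N"] \<delta>_def abs_of_nat
    by (intro mult_left_mono abs_arctan_le) auto
  also have "\<dots> = \<bar>v * T / 2\<bar>" using assms by (simp add: h_def abs_mult)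
  finally have N\<delta>: "\<bar>real N * \<delta>\<bar> \<le> \<bar>v * T / 2\<bar>" .
  have c: "cos (v * T / 2) \<le> cos (real N * \<delta>)"
  proof -
    have "cos \<bar>v * T / 2\<bar> \<le> cos \<bar>real N * \<delta>\<bar>"
      using N\<delta> vT by (intro cos_monotone_0_pi_le) auto
    then show ?thesis by (simp only: cos_abs_real)
  qed
  have c0: "0 < cos (v * T / 2)" using vT by (intro cos_gt_zero_pi) auto
  have \<delta>: "0 \<le> cos \<delta>"
    unfolding \<delta>_def using arctan_bounded[of "h * (v / 2)"] by (intro cos_ge_zero) auto
  have "(\<integral>\<^sup>+\<omega>. ennreal (exp (v * discrete_area h N \<omega>)) \<partial>M)
      = ennreal (cos \<delta> ^ N / cos (real N * \<delta>))"
    using discrete_area_exp_moment[OF h \<delta>_def, of 0 N] N\<delta> vT by simp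
  also have "\<dots> \<le> ennreal (1 / cos (v * T / 2))"
    using c c0 \<delta> by (intro ennreal_leI frac_le power_le_one) auto
  finally show ?thesis by (simp add: h_def)
qed

text \<open>\<open>discrete_area\<close> is half the difference of the Riemann sums of the two Ito
  integrals, each with mean-square error at most 4 T^2 / N. The factor 1/4 from the halving is
  discarded, whence 2 * 4 + 2 * 4 = 16.\<close>

lemma discrete_area_error:
  assumes T: "0 < T" and N: "0 < N" and S: "levy_area M B T S"
  shows "(\<integral>\<^sup>+\<omega>. ennreal ((S \<omega> - discrete_area (T / real N) N \<omega>)\<^sup>2) \<partial>M) \<le> ennreal (16 * T\<^sup>2 / real N)"
proof -
  obtain I J where I: "has_ito_integral M \<F> (\<lambda>t \<omega>. B t \<omega> $ 2) T (\<lambda>t \<omega>. B t \<omega> $ 1) I"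
    and J: "has_ito_integral M \<F> (\<lambda>t \<omega>. B t \<omega> $ 1) T (\<lambda>t \<omega>. B t \<omega> $ 2) J"
    and SIJ: "AE \<omega> in M. S \<omega> = (1 / 2) * (I \<omega> - J \<omega>)"
    using S unfolding levy_area_def by blast
  have mI [measurable]: "I \<in> borel_measurable M" "J \<in> borel_measurable M"
    using I J by (auto simp: has_ito_integral_def)
  define R where "R i j = simple_ito_integral N (\<lambda>q. q * T / N) (\<lambda>q \<omega>. B (q * T / N) \<omega> $ j) (\<lambda>t \<omega>. B t \<omega> $ i)" for i j
  have mR [measurable]: "R i j \<in> borel_measurable M" for i j
    unfolding R_def by (rule measurable_simple_ito[OF simple_process_data_riemann[OF T N]])
  have A: "discrete_area (T / real N) N \<omega> = (1 / 2) * (R 2 1 \<omega> - R 1 2 \<omega>)" for \<omega>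
    by (simp add: discrete_area_def R_def simple_ito_integral_def sum_subtractf)
  have "(\<integral>\<^sup>+\<omega>. ennreal ((S \<omega> - discrete_area (T / real N) N \<omega>)\<^sup>2) \<partial>M)
      \<le> (\<integral>\<^sup>+\<omega>. 2 * ennreal ((I \<omega> - R 2 1 \<omega>)\<^sup>2) + 2 * ennreal ((J \<omega> - R 1 2 \<omega>)\<^sup>2) \<partial>M)"
  proof (intro nn_integral_mono_AE, use SIJ in eventually_elim)
    fix \<omega> assume "S \<omega> = (1 / 2) * (I \<omega> - J \<omega>)"
    then have "S \<omega> - discrete_area (T / real N) N \<omega> = ((I \<omega> - R 2 1 \<omega>) - (J \<omega> - R 1 2 \<omega>)) / 2"
      by (simp add: A field_simps)
    then have "(S \<omega> - discrete_area (T / real N) N \<omega>)\<^sup>2 \<le> ((I \<omega> - R 2 1 \<omega>) - (J \<omega> - R 1 2 \<omega>))\<^sup>2"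
      by (simp only: power_divide) simp
    then have "ennreal ((S \<omega> - discrete_area (T / real N) N \<omega>)\<^sup>2) \<le> ennreal (((I \<omega> - R 2 1 \<omega>) - (J \<omega> - R 1 2 \<omega>))\<^sup>2)"
      by (rule ennreal_leI)
    also have "\<dots> \<le> 2 * ennreal ((I \<omega> - R 2 1 \<omega> - 0)\<^sup>2) + 2 * ennreal ((0 - (J \<omega> - R 1 2 \<omega>))\<^sup>2)"
      by (rule ennreal_square_diff_le)
    finally show "ennreal ((S \<omega> - discrete_area (T / real N) N \<omega>)\<^sup>2)
        \<le> 2 * ennreal ((I \<omega> - R 2 1 \<omega>)\<^sup>2) + 2 * ennreal ((J \<omega> - R 1 2 \<omega>)\<^sup>2)"
      by (simp add: power2_commute)
  qed
  also have "\<dots> = 2 * (\<integral>\<^sup>+\<omega>. ennreal ((I \<omega> - R 2 1 \<omega>)\<^sup>2) \<partial>M) + 2 * (\<integral>\<^sup>+\<omega>. ennreal ((J \<omega> - R 1 2 \<omega>)\<^sup>2) \<partial>M)"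
    by (simp add: nn_integral_add nn_integral_cmult)
  also have "\<dots> \<le> 2 * ennreal (4 * T\<^sup>2 / N) + 2 * ennreal (4 * T\<^sup>2 / N)"
    using ito_riemann_error[OF T N I] ito_riemann_error[OF T N J]
    by (intro add_mono mult_left_mono) (auto simp: R_def)
  also have "\<dots> = ennreal (16 * T\<^sup>2 / real N)"
  proof -
    have "2 * ennreal (4 * T\<^sup>2 / N) = ennreal (2 * (4 * T\<^sup>2 / N))" by (subst ennreal_mult') auto
    then show ?thesis by (simp flip: ennreal_plus)
  qed
  finally show ?thesis .
qed

text \<open>Mean-square convergence gives almost sure convergence only along a subsequence, which is
  enough because the moment bound holds for every number of pieces. The index \<open>Suc n\<close>
  keeps that number positive.\<close>

lemma levy_area_exp_moment:
  assumes T: "0 < T" and S: "levy_area M B T S" and v: "\<bar>v\<bar> < pi / T"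
  shows "(\<integral>\<^sup>+\<omega>. ennreal (exp (v * S \<omega>)) \<partial>M) \<le> ennreal (1 / cos (v * T / 2))"
proof -
  define A where "A n = discrete_area (T / real (Suc n)) (Suc n)" for n
  have [measurable]: "S \<in> borel_measurable M" using S by (simp add: levy_area_def)
  have [measurable]: "A n \<in> borel_measurable M" for n
    unfolding A_def using T by (intro measurable_F[OF measurable_discrete_area]) auto
  define E where "E n = (\<integral>\<^sup>+\<omega>. ennreal ((S \<omega> - A n \<omega>)\<^sup>2) \<partial>M)" for n
  have E: "E n \<le> ennreal (16 * T\<^sup>2 / real (Suc n))" for n
    unfolding E_def A_def by (rule discrete_area_error[OF T _ S]) simp
  have int: "integrable M (\<lambda>\<omega>. (S \<omega> - A n \<omega>)\<^sup>2)" for n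
  proof (rule integrableI_nonneg)
    show "(\<integral>\<^sup>+\<omega>. ennreal ((S \<omega> - A n \<omega>)\<^sup>2) \<partial>M) < \<infinity>"
      using E[of n] unfolding E_def by (auto intro: le_less_trans)
  qed auto
  have bound: "(\<integral>\<omega>. norm ((S \<omega> - A n \<omega>)\<^sup>2) \<partial>M) \<le> 16 * T\<^sup>2 / real (Suc n)" for n
  proof -
    have "ennreal (\<integral>\<omega>. (S \<omega> - A n \<omega>)\<^sup>2 \<partial>M) = E n"
      unfolding E_def by (intro nn_integral_eq_integral[symmetric] int) auto
    with E[of n] have "ennreal (\<integral>\<omega>. (S \<omega> - A n \<omega>)\<^sup>2 \<partial>M) \<le> ennreal (16 * T\<^sup>2 / real (Suc n))" by metis
    moreover have "0 \<le> 16 * T\<^sup>2 / real (Suc n)" by simp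
    ultimately have "(\<integral>\<omega>. (S \<omega> - A n \<omega>)\<^sup>2 \<partial>M) \<le> 16 * T\<^sup>2 / real (Suc n)"
      by (simp only: ennreal_le_iff)
    then show ?thesis by simp
  qed
  have "(\<lambda>n. \<integral>\<omega>. norm ((S \<omega> - A n \<omega>)\<^sup>2) \<partial>M) \<longlonglongrightarrow> 0"
  proof (rule real_tendsto_sandwich[OF _ _ tendsto_const])
    show "(\<lambda>n. 16 * T\<^sup>2 / real (Suc n)) \<longlonglongrightarrow> 0"
      by (rule LIMSEQ_Suc[OF lim_const_over_n])
  qed (simp, intro always_eventually allI bound)
  then obtain r :: "nat \<Rightarrow> nat" where r: "AE \<omega> in M. (\<lambda>n. (S \<omega> - A (r n) \<omega>)\<^sup>2) \<longlonglongrightarrow> 0"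
    using tendsto_L1_AE_subseq[of M "\<lambda>n \<omega>. (S \<omega> - A n \<omega>)\<^sup>2"] int by blast
  have "AE \<omega> in M. ennreal (exp (v * S \<omega>)) = liminf (\<lambda>n. ennreal (exp (v * A (r n) \<omega>)))"
    using r
  proof eventually_elim
    fix \<omega> assume "(\<lambda>n. (S \<omega> - A (r n) \<omega>)\<^sup>2) \<longlonglongrightarrow> 0"
    then have "(\<lambda>n. sqrt ((S \<omega> - A (r n) \<omega>)\<^sup>2)) \<longlonglongrightarrow> sqrt 0" by (rule tendsto_real_sqrt)
    then have "(\<lambda>n. S \<omega> - A (r n) \<omega>) \<longlonglongrightarrow> 0" by (simp add: tendsto_rabs_zero_iff)
    from tendsto_diff[OF tendsto_const[of "S \<omega>"] this]
    have "(\<lambda>n. A (r n) \<omega>) \<longlonglongrightarrow> S \<omega>" by simp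
    then have "(\<lambda>n. ennreal (exp (v * A (r n) \<omega>))) \<longlonglongrightarrow> ennreal (exp (v * S \<omega>))"
      by (intro tendsto_ennrealI tendsto_intros)
    then show "ennreal (exp (v * S \<omega>)) = liminf (\<lambda>n. ennreal (exp (v * A (r n) \<omega>)))"
      by (intro lim_imp_Liminf[symmetric]) auto
  qed
  then have "(\<integral>\<^sup>+\<omega>. ennreal (exp (v * S \<omega>)) \<partial>M) = (\<integral>\<^sup>+\<omega>. liminf (\<lambda>n. ennreal (exp (v * A (r n) \<omega>))) \<partial>M)"
    by (rule nn_integral_cong_AE)
  also have "\<dots> \<le> liminf (\<lambda>n. \<integral>\<^sup>+\<omega>. ennreal (exp (v * A (r n) \<omega>)) \<partial>M)"
    by (rule nn_integral_liminf) measurable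
  also have "\<dots> \<le> ennreal (1 / cos (v * T / 2))"
    unfolding A_def by (intro Liminf_le always_eventually allI discrete_area_exp_le[OF T _ v]) auto
  finally show ?thesis .
qed

end

theorem proposition4p8:
  fixes M :: "'a measure"
    and B :: "'n::finite \<Rightarrow> real \<Rightarrow> 'a \<Rightarrow> real ^ 2"
    and S :: "'n \<Rightarrow> 'a \<Rightarrow> real"
    and g :: "real ^ 'n \<Rightarrow> real"
    and c T x :: real
  assumes "prob_space M"
    and "c > 0" and "T > 0"
    and "\<And>u v. \<bar>g u - g v\<bar> \<le> c * (\<Sum>i\<in>UNIV. \<bar>u $ i - v $ i\<bar>)"
    and "\<And>i. brownian_motion M (B i)"
    and "\<And>i. levy_area M (B i) T (S i)"
    and "prob_space.indep_vars M (\<lambda>_. borel) S UNIV"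
    and "x > 0"
  shows "measure M {\<omega> \<in> space M.
           g (\<chi> i. S i \<omega>) - prob_space.expectation M (\<lambda>\<omega>. g (\<chi> i. S i \<omega>)) \<ge> x}
         \<le> (1 + pi * x / (4 * real CARD('n) * c * T)) ^ (4 * CARD('n)) * exp (- (pi * x / (c * T)))"
proof -
  interpret prob_space M by fact
  have "(\<integral>\<^sup>+\<omega>. ennreal (exp (v * S i \<omega>)) \<partial>M) \<le> ennreal (1 / cos (v * T / 2))"
    if "\<bar>v\<bar> < pi / T" for i v
  proof -
    \<comment> \<open>Each Brownian motion is used alone, for the exponential moment of its own
      area; the joint law enters only through the independence of the areas.\<close>
    interpret planar_brownian M "B i" by unfold_locales (rule assms(5))
    show ?thesis by (rule levy_area_exp_moment[OF assms(3) assms(6) that])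
  qed
  then show ?thesis using assms by (intro lipschitz_concentration)
qed

end
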